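(* The Taylor resolution $(\mathcal{T},\delta)$ of $\langle\mathcal{M}\rangle$ is obtained by repeated application of the Schreyer construction, starting from the Gröbner basis $\Delta_0=\mathcal{M}$, provided that at each step the generators $\delta v_{\mathbf{k}}$ are ordered in one of the following two ways: (A) descending by the index $\mathbf{k}$ (using the term orders $\prec_q$), or (B) ascending by the index $\mathbf{k}$ (using the term orders $\prec_q^r$). Precisely: fix (A) or (B), and write $<_q$ for $\prec_q$ in case (A) and for $\prec_q^r$ in case (B). Then for every $q$ with $1\le q\le r$ the set $\Delta_{q-1}$ is a Gröbner basis of $\delta(\mathcal{T}_q)$ for $<_{q-1}$, and, if its elements are numbered according to the chosen ordering and the free module with basis $\{e_{\mathbf{k}}\}$ ($\mathbf{k}$ of length $q$, $e_{\mathbf{k}}$ corresponding to $\delta v_{\mathbf{k}}$) is identified with $\mathcal{T}_q$ via $e_{\mathbf{k}}=v_{\mathbf{k}}$, then: (i) the Schreyer term order on $\mathcal{T}_q$ induced by $\Delta_{q-1}$ is $<_q$; (ii) for a suitable choice of standard representations, the nonzero elements of the Schreyer basis $\Sigma_{\Delta_{q-1}}$ are, up to sign, exactly the elements of $\Delta_q$, so that $\Delta_q$ is a Gröbner basis of the syzygy module $\mathrm{Syz}(\Delta_{q-1})=\ker(\delta:\mathcal{T}_q\to\mathcal{T}_{q-1})$ with respect to $<_q$.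
   Context: Let $\Bbbk$ be a field, $\mathcal{P}=\Bbbk[x_1,\dots,x_n]$, and $\mathcal{M}=\{m_1,\dots,m_r\}\subset\mathcal{P}$ a finite set of $r$ monomials, numbered in a fixed way. An ascending sequence of length $q$ is $\mathbf{k}=(k_1,\dots,k_q)$ with $1\le k_1<\cdots<k_q\le r$; put $m_{\mathbf{k}}=\mathrm{lcm}(m_{k_1},\dots,m_{k_q})$ (and $m_{\emptyset}=1$). Let $\mathbf{k}\setminus k_\ell$ denote $\mathbf{k}$ with the entry $k_\ell$ removed. Let $\mathcal{V}$ be a $\Bbbk$-vector space with basis $v_1,\dots,v_r$, let $\mathcal{T}_q=\mathcal{P}\otimes\Lambda^q\mathcal{V}$, which is a free $\mathcal{P}$-module with basis $v_{\mathbf{k}}=v_{k_1}\wedge\cdots\wedge v_{k_q}$ ($\mathbf{k}$ ascending of length $q$), so $\mathcal{T}_0=\mathcal{P}$. The Taylor differential is the $\mathcal{P}$-linear map $\delta:\mathcal{T}_q\to\mathcal{T}_{q-1}$ with $$\delta v_{\mathbf{k}}=\sum_{\ell=1}^q(-1)^{\ell-1}\frac{m_{\mathbf{k}}}{m_{\mathbf{k}\setminus k_\ell}}\,v_{\mathbf{k}\setminus k_\ell}.$$ It is known (Taylor) that $(\mathcal{T},\delta)$ is a free resolution of $\langle\mathcal{M}\rangle$. A term of $\mathcal{T}_q$ is $s v_{\mathbf{k}}$ with $s$ a monomial; the leading term $\mathrm{lt}$ of an element is its largest term, taken without its coefficient, and $\mathrm{lc}$ denotes the coefficient. For sequences of equal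 length, $\mathbf{k}<\mathbf{l}$ means that $k_j<l_j$ for $j=\min\{i\mid k_i\ne l_i\}$; "ascending/descending by the index" refers to this order. Let $\prec_0=\prec_0^r$ be an arbitrary term order on $\mathcal{P}$. For sequences $\mathbf{k},\mathbf{l}$ of length $q+1$ and monomials $s,t$, set $s v_{\mathbf{k}}\prec_{q+1}t v_{\mathbf{l}}$ if either $\mathrm{lt}_{\prec_q}(s\,\delta v_{\mathbf{k}})\prec_q\mathrm{lt}_{\prec_q}(t\,\delta v_{\mathbf{l}})$, or these are equal and $\mathbf{k}<\mathbf{l}$. The order $\prec^r_{q+1}$ is defined in the same way from $\prec^r_q$, with the last condition replaced by $\mathbf{k}>\mathbf{l}$. Put $\Delta_q=\{\delta v_{\mathbf{k}}\mid\mathbf{k}\text{ ascending of length }q+1\}\subset\mathcal{T}_q$. A finite subset $\mathcal{G}$ of a submodule $\mathcal{J}$ of a free module is a Gröbner basis of $\mathcal{J}$ for $\prec$ if the leading term of every nonzero element of $\mathcal{J}$ is divisible by the leading term of an element of $\mathcal{G}$. Schreyer construction: let $\mathcal{G}=\{g_1,\dots,g_s\}$ be a numbered Gröbner basis for $\prec$ in a free module. The Schreyer term order $\prec_{\mathcal{G}}$ on the free module with basis $e_1,\dots,e_s$ is: $s\,e_\alpha\prec_{\mathcal{G}}t\,e_\beta$ (with $s,t$ monomials) if $\mathrm{lt}_\prec(s g_\alpha)\prec\mathrm{lt}_\prec(t g_\beta)$, or these leading terms are equal and $\beta<\alpha$. For $a<b$ with $\mathrm{lt}\,g_a=\mu_a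 e$, $\mathrm{lt}\,g_b=\mu_b e$ in the same component $e$ and $\mu_{ab}=\mathrm{lcm}(\mu_a,\mu_b)$, choose a standard representation $$\frac{\mu_{ab}}{\mathrm{lc}(g_a)\mu_a}g_a-\frac{\mu_{ab}}{\mathrm{lc}(g_b)\mu_b}g_b=\sum_c P_{abc}g_c$$ (that is, $\mathrm{lt}(P_{abc}g_c)\preceq$ the leading term of the left side whenever $P_{abc}\ne0$) and put $\mathbf{S}_{ab}=\frac{\mu_{ab}}{\mathrm{lc}(g_a)\mu_a}e_a-\frac{\mu_{ab}}{\mathrm{lc}(g_b)\mu_b}e_b-\sum_cP_{abc}e_c$; if the leading terms lie in different components put $\mathbf{S}_{ab}=0$. The Schreyer basis is $\Sigma_{\mathcal{G}}=\{\mathbf{S}_{ab}\mid a<b\}$; the Schreyer theorem states that it is a Gröbner basis of $\mathrm{Syz}(\mathcal{G})$ for $\prec_{\mathcal{G}}$. Here $\mathrm{Syz}(\mathcal{G})$ is the module of all $\sum_cP_ce_c$ with $\sum_cP_cg_c=0$. *)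

theory Defs
  imports "HOL-Library.Poly_Mapping" Complex_Main
begin

text \<open>
  Monomials in the variables indexed by \<open>'n\<close> are exponent vectors, written additively: the product of
  \<open>s\<close> and \<open>t\<close> is \<open>s + t\<close>, and \<open>t - s\<close> is the quotient \<open>t / s\<close> whenever \<open>s\<close> divides \<open>t\<close>.
  An element of the free module with basis \<open>e\<^sub>b\<close> (\<open>b :: 'b\<close>) is its finitely supported family of
  coefficients, so \<open>e\<^sub>b\<close> is \<open>Poly_Mapping.single b 1\<close>; the pair \<open>(s, b)\<close> is the term \<open>s e\<^sub>b\<close>.
\<close>

type_synonym 'n mon = "'n \<Rightarrow>\<^sub>0 nat"
type_synonym ('n, 'k) mpoly = "'n mon \<Rightarrow>\<^sub>0 'k"
type_synonym ('b, 'n, 'k) fmod = "'b \<Rightarrow>\<^sub>0 ('n, 'k) mpoly"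
type_synonym ('b, 'n) fterm = "'n mon \<times> 'b"

lift_definition mon_lcm :: "'n mon \<Rightarrow> 'n mon \<Rightarrow> 'n mon" is "\<lambda>s t x. max (s x) (t x)"
proof -
  fix s t :: "'n \<Rightarrow> nat"
  assume "finite {x. s x \<noteq> 0}" "finite {x. t x \<noteq> 0}"
  then show "finite {x. max (s x) (t x) \<noteq> 0}"
    by (rule finite_subset[OF _ finite_UnI, rotated]) (auto simp: max_def)
qed

lemma mon_lcm_least:
  "(\<exists>w. u = mon_lcm s t + w) \<longleftrightarrow> (\<exists>w. u = s + w) \<and> (\<exists>w. u = t + w)"
proof -
  have dvd: "(\<exists>w. u = s + w) \<longleftrightarrow> (\<forall>x. Poly_Mapping.lookup s x \<le> Poly_Mapping.lookup u x)"
    for s u :: "'n mon"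
  proof
    assume "\<forall>x. Poly_Mapping.lookup s x \<le> Poly_Mapping.lookup u x"
    then have "u = s + (u - s)"
      by (intro poly_mapping_eqI) (simp add: lookup_add lookup_minus)
    then show "\<exists>w. u = s + w" ..
  qed (auto simp: lookup_add)
  show ?thesis
    unfolding dvd by (auto simp: mon_lcm.rep_eq)
qed

definition term_order :: "('n mon \<Rightarrow> 'n mon \<Rightarrow> bool) \<Rightarrow> bool" where
  "term_order ord \<longleftrightarrow> irreflp ord \<and> transp ord \<and> totalp ord \<and>
     (\<forall>s t u. ord s t \<longrightarrow> ord (s + u) (t + u)) \<and> (\<forall>s. s \<noteq> 0 \<longrightarrow> ord 0 s)"

definition fscale :: "('n, 'k::field) mpoly \<Rightarrow> ('b, 'n, 'k) fmod \<Rightarrow> ('b, 'n, 'k) fmod" where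
  "fscale p f = Poly_Mapping.map (\<lambda>c. p * c) f"

lemma lookup_fscale: "Poly_Mapping.lookup (fscale p f) b = p * Poly_Mapping.lookup f b"
  by (simp add: fscale_def Poly_Mapping.map.rep_eq when_def)

lemma module_fscale: "module (fscale :: _ \<Rightarrow> ('b, 'n, 'k::field) fmod \<Rightarrow> _)"
  by unfold_locales
    (auto intro!: poly_mapping_eqI simp: lookup_fscale lookup_add algebra_simps)

abbreviation submodule :: "('b, 'n, 'k::field) fmod set \<Rightarrow> bool" where
  "submodule \<equiv> module.subspace fscale"

definition free_module :: "'b set \<Rightarrow> ('b, 'n, 'k::field) fmod set" where
  "free_module B = {f. Poly_Mapping.keys f \<subseteq> B}"

definition fterms :: "('b, 'n, 'k::field) fmod \<Rightarrow> ('b, 'n) fterm set" where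
  "fterms f = {(s, b). Poly_Mapping.lookup (Poly_Mapping.lookup f b) s \<noteq> 0}"

text \<open>Orders on terms are given by their strict part; \<open>lt prec f\<close> is meaningful only for \<open>f \<noteq> 0\<close>.\<close>

definition lt :: "(('b, 'n) fterm \<Rightarrow> ('b, 'n) fterm \<Rightarrow> bool) \<Rightarrow> ('b, 'n, 'k::field) fmod
    \<Rightarrow> ('b, 'n) fterm" where
  "lt prec f = (THE u. u \<in> fterms f \<and> (\<forall>w\<in>fterms f. w \<noteq> u \<longrightarrow> prec w u))"

definition lc :: "(('b, 'n) fterm \<Rightarrow> ('b, 'n) fterm \<Rightarrow> bool) \<Rightarrow> ('b, 'n, 'k::field) fmod \<Rightarrow> 'k" where
  "lc prec f = (case lt prec f of (s, b) \<Rightarrow> Poly_Mapping.lookup (Poly_Mapping.lookup f b) s)"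

definition term_dvd :: "('b, 'n) fterm \<Rightarrow> ('b, 'n) fterm \<Rightarrow> bool" where
  "term_dvd u w \<longleftrightarrow> snd u = snd w \<and> (\<exists>t. fst w = fst u + t)"

definition groebner_basis :: "(('b, 'n) fterm \<Rightarrow> ('b, 'n) fterm \<Rightarrow> bool)
    \<Rightarrow> ('b, 'n, 'k::field) fmod set \<Rightarrow> ('b, 'n, 'k) fmod set \<Rightarrow> bool" where
  "groebner_basis prec J G \<longleftrightarrow> submodule J \<and> finite G \<and> G \<subseteq> J \<and>
     (\<forall>f\<in>J. f \<noteq> 0 \<longrightarrow> (\<exists>g\<in>G. g \<noteq> 0 \<and> term_dvd (lt prec g) (lt prec f)))"

text \<open>
  A numbered family \<open>g\<^sub>1, \<dots>, g\<^sub>s\<close> is a list \<open>gs\<close>; its indices, which are also the basis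
  indices of the free module containing the syzygies, run from \<open>0\<close> to \<open>length gs - 1\<close>.
\<close>

definition schreyer_less :: "(('b, 'n) fterm \<Rightarrow> ('b, 'n) fterm \<Rightarrow> bool)
    \<Rightarrow> ('b, 'n, 'k::field) fmod list \<Rightarrow> (nat, 'n) fterm \<Rightarrow> (nat, 'n) fterm \<Rightarrow> bool" where
  "schreyer_less prec gs = (\<lambda>(s, a) (t, b).
     let u = lt prec (fscale (Poly_Mapping.single s 1) (gs ! a));
         w = lt prec (fscale (Poly_Mapping.single t 1) (gs ! b))
     in prec u w \<or> u = w \<and> b < a)"

definition syz :: "('b, 'n, 'k::field) fmod list \<Rightarrow> (nat, 'n, 'k) fmod set" where
  "syz gs = {p \<in> free_module {..<length gs}.
     (\<Sum>c<length gs. fscale (Poly_Mapping.lookup p c) (gs ! c)) = 0}"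

text \<open>The multiplier \<open>\<mu>\<^sub>a\<^sub>b / (lc(g\<^sub>a) \<mu>\<^sub>a)\<close> of \<open>g = g\<^sub>a\<close> in the S-polynomial with \<open>h = g\<^sub>b\<close>.\<close>

definition spoly_coeff :: "(('b, 'n) fterm \<Rightarrow> ('b, 'n) fterm \<Rightarrow> bool)
    \<Rightarrow> ('b, 'n, 'k::field) fmod \<Rightarrow> ('b, 'n, 'k) fmod \<Rightarrow> ('n, 'k) mpoly" where
  "spoly_coeff prec g h = (let \<mu> = fst (lt prec g); \<nu> = fst (lt prec h)
     in Poly_Mapping.single (mon_lcm \<mu> \<nu> - \<mu>) (1 / lc prec g))"

definition same_component :: "(('b, 'n) fterm \<Rightarrow> ('b, 'n) fterm \<Rightarrow> bool)
    \<Rightarrow> ('b, 'n, 'k::field) fmod \<Rightarrow> ('b, 'n, 'k) fmod \<Rightarrow> bool" where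
  "same_component prec g h \<longleftrightarrow> snd (lt prec g) = snd (lt prec h)"

definition spoly :: "(('b, 'n) fterm \<Rightarrow> ('b, 'n) fterm \<Rightarrow> bool)
    \<Rightarrow> ('b, 'n, 'k::field) fmod \<Rightarrow> ('b, 'n, 'k) fmod \<Rightarrow> ('b, 'n, 'k) fmod" where
  "spoly prec g h = fscale (spoly_coeff prec g h) g - fscale (spoly_coeff prec h g) h"

text \<open>The clause \<open>f \<noteq> 0\<close> makes the zero representation the only standard one of \<open>0\<close>, which has
  no leading term.\<close>

definition standard_representation :: "(('b, 'n) fterm \<Rightarrow> ('b, 'n) fterm \<Rightarrow> bool)
    \<Rightarrow> ('b, 'n, 'k::field) fmod list \<Rightarrow> ('b, 'n, 'k) fmod \<Rightarrow> (nat \<Rightarrow> ('n, 'k) mpoly) \<Rightarrow> bool" where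
  "standard_representation prec gs f P \<longleftrightarrow>
     f = (\<Sum>c<length gs. fscale (P c) (gs ! c)) \<and>
     (\<forall>c<length gs. P c \<noteq> 0 \<longrightarrow>
        f \<noteq> 0 \<and> (let u = lt prec (fscale (P c) (gs ! c)) in prec u (lt prec f) \<or> u = lt prec f))"

definition standard_choice :: "(('b, 'n) fterm \<Rightarrow> ('b, 'n) fterm \<Rightarrow> bool)
    \<Rightarrow> ('b, 'n, 'k::field) fmod list \<Rightarrow> (nat \<Rightarrow> nat \<Rightarrow> nat \<Rightarrow> ('n, 'k) mpoly) \<Rightarrow> bool" where
  "standard_choice prec gs P \<longleftrightarrow>
     (\<forall>a b. a < b \<longrightarrow> b < length gs \<longrightarrow> same_component prec (gs ! a) (gs ! b) \<longrightarrow>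
        standard_representation prec gs (spoly prec (gs ! a) (gs ! b)) (P a b))"

definition schreyer_syz :: "(('b, 'n) fterm \<Rightarrow> ('b, 'n) fterm \<Rightarrow> bool)
    \<Rightarrow> ('b, 'n, 'k::field) fmod list \<Rightarrow> (nat \<Rightarrow> nat \<Rightarrow> nat \<Rightarrow> ('n, 'k) mpoly) \<Rightarrow> nat \<Rightarrow> nat
    \<Rightarrow> (nat, 'n, 'k) fmod" where
  "schreyer_syz prec gs P a b =
     (if same_component prec (gs ! a) (gs ! b)
      then Poly_Mapping.single a (spoly_coeff prec (gs ! a) (gs ! b))
         - Poly_Mapping.single b (spoly_coeff prec (gs ! b) (gs ! a))
         - (\<Sum>c<length gs. Poly_Mapping.single c (P a b c))
      else 0)"

definition schreyer_basis :: "(('b, 'n) fterm \<Rightarrow> ('b, 'n) fterm \<Rightarrow> bool)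
    \<Rightarrow> ('b, 'n, 'k::field) fmod list \<Rightarrow> (nat \<Rightarrow> nat \<Rightarrow> nat \<Rightarrow> ('n, 'k) mpoly)
    \<Rightarrow> (nat, 'n, 'k) fmod set" where
  "schreyer_basis prec gs P = {schreyer_syz prec gs P a b | a b. a < b \<and> b < length gs}"

definition seqs :: "nat \<Rightarrow> nat \<Rightarrow> nat list set" where
  "seqs r q = {k. length k = q \<and> sorted_wrt (<) k \<and> set k \<subseteq> {1..r}}"

definition seq_less :: "nat list \<Rightarrow> nat list \<Rightarrow> bool" where
  "seq_less k l \<longleftrightarrow> (k, l) \<in> lex less_than"

definition drop_entry :: "nat \<Rightarrow> nat list \<Rightarrow> nat list" where
  "drop_entry i k = take (i - 1) k @ drop i k"

definition lcm_seq :: "(nat \<Rightarrow> 'n mon) \<Rightarrow> nat list \<Rightarrow> 'n mon" where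
  "lcm_seq m k = foldr (\<lambda>i. mon_lcm (m i)) k 0"

text \<open>Rather than as \<open>\<P> \<otimes> \<Lambda>\<^sup>q \<V>\<close>, the module \<open>\<T>\<^sub>q\<close> is represented through its
  basis \<open>v\<^sub>k\<close>; the ring \<open>\<P> = \<T>\<^sub>0\<close> is the free module on the empty sequence.\<close>

definition taylor_module :: "nat \<Rightarrow> nat \<Rightarrow> (nat list, 'n, 'k::field) fmod set" where
  "taylor_module r q = free_module (seqs r q)"

definition delta_basis :: "(nat \<Rightarrow> 'n mon) \<Rightarrow> nat list \<Rightarrow> (nat list, 'n, 'k::field) fmod" where
  "delta_basis m k = (\<Sum>i = 1..length k.
     Poly_Mapping.single (drop_entry i k)
       (Poly_Mapping.single (lcm_seq m k - lcm_seq m (drop_entry i k)) ((-1) ^ (i - 1))))"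

definition delta :: "(nat \<Rightarrow> 'n mon) \<Rightarrow> (nat list, 'n, 'k::field) fmod
    \<Rightarrow> (nat list, 'n, 'k) fmod" where
  "delta m f = (\<Sum>k\<in>Poly_Mapping.keys f. fscale (Poly_Mapping.lookup f k) (delta_basis m k))"

definition Delta :: "(nat \<Rightarrow> 'n mon) \<Rightarrow> nat \<Rightarrow> nat \<Rightarrow> (nat list, 'n, 'k::field) fmod set" where
  "Delta m r q = {delta_basis m k | k. k \<in> seqs r (Suc q)}"

datatype arrangement = Descending | Ascending

text \<open>
  \<open>numbering d r q ks\<close>: the list \<open>ks\<close> enumerates the sequences of length \<open>q\<close>, and hence the
  generators of \<open>\<delta>(\<T>\<^sub>q)\<close>, in descending respectively ascending order.
\<close>

definition numbering :: "arrangement \<Rightarrow> nat \<Rightarrow> nat \<Rightarrow> nat list list \<Rightarrow> bool" where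
  "numbering d r q ks \<longleftrightarrow> set ks = seqs r q \<and>
     sorted_wrt (case d of Descending \<Rightarrow> (\<lambda>k l. seq_less l k) | Ascending \<Rightarrow> seq_less) ks"

lemma ex_numbering: "\<exists>ks. numbering d r q ks"
proof -
  have list: "\<exists>xs. set xs = A \<and> sorted_wrt R xs"
    if "finite A" and tr: "\<And>x y z. R x y \<Longrightarrow> R y z \<Longrightarrow> R x z"
      and tot: "\<And>x y. x \<in> B \<Longrightarrow> y \<in> B \<Longrightarrow> x \<noteq> y \<Longrightarrow> R x y \<or> R y x" and "A \<subseteq> B"
    for R :: "nat list \<Rightarrow> nat list \<Rightarrow> bool" and A B
    using that(1,4)
  proof (induction A rule: finite_induct)
    case empty
    then show ?case by simp
  next
    case (insert x A)
    then obtain xs where xs: "set xs = A" "sorted_wrt R xs" by auto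
    let ?ys = "filter (\<lambda>y. R y x) xs @ x # filter (\<lambda>y. \<not> R y x) xs"
    have "R x y" if "y \<in> A" "\<not> R y x" for y
      using tot[of x y] insert.prems insert.hyps(2) that by blast
    then have "sorted_wrt R ?ys"
      using xs tr by (auto simp: sorted_wrt_append sorted_wrt_filter)
    moreover have "set ?ys = insert x A" using xs(1) by auto
    ultimately show ?case by blast
  qed
  have "seqs r q \<subseteq> {k. set k \<subseteq> {1..r} \<and> length k = q}"
    by (auto simp: seqs_def)
  then have fin: "finite (seqs r q)"
    by (rule finite_subset) (simp add: finite_lists_length_eq)
  have tr: "seq_less x z" if "seq_less x y" "seq_less y z" for x y z
    using that lex_transI[of less_than] unfolding seq_less_def by (meson trans_less_than transD)
  have tot: "seq_less k l \<or> seq_less l k" if "k \<in> seqs r q" "l \<in> seqs r q" "k \<noteq> l" for k l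
  proof -
    have "length k = length l \<Longrightarrow> k \<noteq> l \<Longrightarrow> seq_less k l \<or> seq_less l k"
      by (induction k l rule: list_induct2) (auto simp: seq_less_def)
    then show ?thesis using that by (auto simp: seqs_def)
  qed
  show ?thesis
  proof (cases d)
    case Descending
    show ?thesis
      unfolding numbering_def Descending arrangement.case
      by (rule list[OF fin _ _ subset_refl]) (use tr tot in blast)+
  next
    case Ascending
    show ?thesis
      unfolding numbering_def Ascending arrangement.case
      by (rule list[OF fin _ _ subset_refl]) (use tr tot in blast)+
  qed
qed

text \<open>
  \<open>taylor_less\<close> is \<open>\<prec>\<^sub>q\<close> for \<open>Descending\<close> and \<open>\<prec>\<^sup>r\<^sub>q\<close> for \<open>Ascending\<close>. It
  compares terms of \<open>\<T>\<^sub>q\<close> only; the coefficient field enters through \<open>\<delta>\<close> and is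
  therefore passed as a type argument.
\<close>

primrec taylor_less :: "'k::field itself \<Rightarrow> arrangement \<Rightarrow> (nat \<Rightarrow> 'n mon)
    \<Rightarrow> ('n mon \<Rightarrow> 'n mon \<Rightarrow> bool) \<Rightarrow> nat
    \<Rightarrow> (nat list, 'n) fterm \<Rightarrow> (nat list, 'n) fterm \<Rightarrow> bool" where
  "taylor_less K d m ord 0 = (\<lambda>(s, k) (t, l). ord s t)"
| "taylor_less K d m ord (Suc q) = (\<lambda>(s, k) (t, l).
     let prec = taylor_less K d m ord q;
         u = lt prec (fscale (Poly_Mapping.single s 1) (delta_basis m k :: (nat list, 'n, 'k) fmod));
         w = lt prec (fscale (Poly_Mapping.single t 1) (delta_basis m l :: (nat list, 'n, 'k) fmod))
     in prec u w \<or>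
        u = w \<and> (case d of Descending \<Rightarrow> seq_less k l | Ascending \<Rightarrow> seq_less l k))"

text \<open>The identification \<open>e\<^sub>a = v\<^bsub>ks ! a\<^esub>\<close> of the free module of the Schreyer construction
  with \<open>\<T>\<^sub>q\<close>.\<close>

definition relabel :: "nat list list \<Rightarrow> (nat, 'n, 'k::field) fmod \<Rightarrow> (nat list, 'n, 'k) fmod" where
  "relabel ks f = (\<Sum>a\<in>Poly_Mapping.keys f. Poly_Mapping.single (ks ! a) (Poly_Mapping.lookup f a))"

end

theory Submission
  imports Defs
begin

text \<open>
  The differential \<open>\<delta>\<close> preserves the grading in which \<open>s v\<^sub>k\<close> has degree \<open>s m\<^sub>k\<close>. Following
  the recursive definition of \<open>\<prec>\<^sub>q\<close> down to \<open>q = 0\<close> shows that it compares degrees by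
  \<open>\<prec>\<^sub>0\<close> and, within one degree, the indices lexicographically from one end: in arrangement (A)
  starting with the last entries, in arrangement (B) starting with the first entries and with the
  comparison reversed (\<open>taylor_less_iff\<close>). Among the indices \<open>k \<setminus> k\<^sub>\<ell>\<close> of the terms of
  \<open>\<delta> v\<^sub>k\<close>, the largest one then lacks the first entry in case (A) and the last entry in case (B).
  The constructor \<open>pcons\<close> adjoins an entry at this end, so that the leading term of
  \<open>\<delta> v\<^bsub>pcons x n\<^esub>\<close> lies in component \<open>n\<close>, and the two cases become one.

  The Groebner basis property is shown directly for the cycles (\<open>kernel_lt_divisible\<close>).
  If \<open>s v\<^sub>l\<close> is the leading term of a cycle \<open>f\<close>, the leading term of \<open>s \<delta> v\<^sub>l\<close> has to cancel in \<open>\<delta> f\<close>. The closed form of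
  the order permits this only against a term \<open>t v\<^sub>k\<close> of \<open>f\<close> for which \<open>k\<close> and \<open>l\<close> differ in
  nothing but the adjoined entry; adjoining that entry of \<open>k\<close> to \<open>l\<close> gives a sequence \<open>p\<close> such
  that the leading term of \<open>\<delta> v\<^sub>p\<close> divides \<open>s v\<^sub>l\<close>. Boundaries are cycles, which settles the images
  \<open>\<delta>(\<T>\<^sub>q)\<close> for \<open>q > 1\<close>; for \<open>q = 1\<close> the image is a monomial ideal.

  The description of the Schreyer order is the definition of \<open>\<prec>\<^sub>q\<close>, once the tie-breaking rule is
  compared with the numbering (\<open>schreyer_less_iff\<close>). For the Schreyer basis, two generators have
  leading terms in the same component exactly if their indices are \<open>k = pcons x n\<close> and
  \<open>l = pcons y n\<close>. The union \<open>p\<close> of \<open>k\<close> and \<open>l\<close> is a sequence of the next length, each \<open>p\<close>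
  comes from exactly one such pair, and up to sign the S-polynomial consists of the two summands of
  \<open>\<delta> (\<delta> v\<^sub>p)\<close> that involve \<open>\<delta> v\<^sub>k\<close> and \<open>\<delta> v\<^sub>l\<close>. Hence \<open>\<delta> (\<delta> v\<^sub>p) = 0\<close> itself is a
  representation of the S-polynomial, and the resulting syzygy is \<open>\<delta> v\<^sub>p\<close> in case (A) and
  \<open>- \<delta> v\<^sub>p\<close> in case (B) (\<open>relabel_S\<close>). The representation is standard because the leading term of
  each of its summands occurs with nonzero coefficient in the S-polynomial
  (\<open>standard_taylor_representation\<close>).
\<close>

section \<open>Monomials\<close>

definition mon_dvd :: "'n mon \<Rightarrow> 'n mon \<Rightarrow> bool" where
  "mon_dvd s t \<longleftrightarrow> (\<exists>w. t = s + w)"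

lemma mon_dvd_iff_lookup:
  "mon_dvd s t \<longleftrightarrow> (\<forall>x. Poly_Mapping.lookup s x \<le> Poly_Mapping.lookup t x)"
proof
  assume "\<forall>x. Poly_Mapping.lookup s x \<le> Poly_Mapping.lookup t x"
  then have "t = s + (t - s)"
    by (intro poly_mapping_eqI) (simp add: lookup_add lookup_minus)
  then show "mon_dvd s t" unfolding mon_dvd_def ..
qed (auto simp: mon_dvd_def lookup_add)

lemma mon_dvd_diff_add: "mon_dvd s t \<Longrightarrow> t - s + s = t"
  by (auto simp: mon_dvd_def add.commute)

lemma mon_dvd_antisym: "mon_dvd s t \<Longrightarrow> mon_dvd t s \<Longrightarrow> s = t"
  unfolding mon_dvd_iff_lookup by (intro poly_mapping_eqI) (meson antisym)

lemma mon_dvd_mon_lcm: "mon_dvd (mon_lcm s t) u \<longleftrightarrow> mon_dvd s u \<and> mon_dvd t u"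
  unfolding mon_dvd_def by (rule mon_lcm_least)

lemma mon_dvd_lcm_seq: "mon_dvd (lcm_seq m k) u \<longleftrightarrow> (\<forall>i\<in>set k. mon_dvd (m i) u)"
proof (induction k)
  case Nil
  then show ?case by (simp add: lcm_seq_def mon_dvd_iff_lookup)
next
  case (Cons i k)
  then show ?case by (simp add: lcm_seq_def mon_dvd_mon_lcm)
qed

lemma mon_dvd_refl [simp]: "mon_dvd s s"
  by (simp add: mon_dvd_iff_lookup)

lemma lcm_seq_mono: "set k \<subseteq> set l \<Longrightarrow> mon_dvd (lcm_seq m k) (lcm_seq m l)"
  using mon_dvd_lcm_seq[of m l "lcm_seq m l"] by (auto simp: mon_dvd_lcm_seq)

lemma lcm_seq_Un: "set p = set k \<union> set l \<Longrightarrow> lcm_seq m p = mon_lcm (lcm_seq m k) (lcm_seq m l)"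
proof -
  assume *: "set p = set k \<union> set l"
  have "mon_dvd (lcm_seq m p) u \<longleftrightarrow> mon_dvd (mon_lcm (lcm_seq m k) (lcm_seq m l)) u" for u
    by (auto simp: mon_dvd_mon_lcm mon_dvd_lcm_seq *)
  then show ?thesis
    using mon_dvd_antisym mon_dvd_refl by blast
qed

lemma mon_quotient_trans:
  assumes "mon_dvd s t" "mon_dvd t u"
  shows "(u - t) + (t - s) = u - s"
proof -
  obtain v w where "t = s + v" "u = s + v + w"
    using assms by (auto simp: mon_dvd_def)
  then show ?thesis by (metis add.assoc add.commute add_diff_cancel_left')
qed

text \<open>
  Dividing two monomials by a common divisor \<open>n\<close> divides their lcm by \<open>n\<close> as well, so the
  quotient of the lcm by either of them does not change. This turns the multipliers of an S-polynomial,
  which are built from the leading monomials \<open>s / n\<close> and \<open>t / n\<close>, into quotients of the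
  lcms \<open>m\<^sub>k\<close>.
\<close>

lemma mon_lcm_quotient:
  assumes "mon_dvd n s" "mon_dvd n t"
  shows "mon_lcm (s - n) (t - n) - (s - n) = mon_lcm s t - s"
  using assms
  by (intro poly_mapping_eqI) (auto simp: mon_dvd_iff_lookup mon_lcm.rep_eq lookup_minus max_def)

lemma sum_single_lookup: "(\<Sum>s\<in>Poly_Mapping.keys p. Poly_Mapping.single s (Poly_Mapping.lookup p s)) = p"
  by (intro poly_mapping_eqI) (simp add: lookup_sum lookup_single when_def sum.delta' in_keys_iff)

lemma lookup_times_single:
  fixes p :: "('n, 'k::field) mpoly"
  shows "Poly_Mapping.lookup (p * Poly_Mapping.single u c) (v + u) = Poly_Mapping.lookup p v * c"
proof -
  have "p * Poly_Mapping.single u c =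
    (\<Sum>s\<in>Poly_Mapping.keys p. Poly_Mapping.single s (Poly_Mapping.lookup p s)) * Poly_Mapping.single u c"
    by (simp add: sum_single_lookup)
  also have "\<dots> = (\<Sum>s\<in>Poly_Mapping.keys p. Poly_Mapping.single (s + u) (Poly_Mapping.lookup p s * c))"
    by (simp add: sum_distrib_right mult_single)
  finally have "Poly_Mapping.lookup (p * Poly_Mapping.single u c) (v + u)
      = (\<Sum>s\<in>Poly_Mapping.keys p. if s = v then Poly_Mapping.lookup p s * c else 0)"
    by (simp add: lookup_sum lookup_single when_def)
  also have "\<dots> = Poly_Mapping.lookup p v * c"
    by (auto simp: sum.delta' in_keys_iff)
  finally show ?thesis .
qed

lemma lookup_times_single_neq_0:
  fixes p :: "('n, 'k::field) mpoly"
  assumes "Poly_Mapping.lookup (p * Poly_Mapping.single u c) w \<noteq> 0"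
  obtains v where "w = v + u" "Poly_Mapping.lookup p v \<noteq> 0"
proof -
  have "w \<in> {a + b |a b. a \<in> Poly_Mapping.keys p \<and> b \<in> Poly_Mapping.keys (Poly_Mapping.single u c)}"
    using keys_mult[of p "Poly_Mapping.single u c"] assms by (auto simp: in_keys_iff)
  then show thesis
    using that by (auto simp: in_keys_iff lookup_single when_def split: if_splits)
qed

section \<open>Leading terms\<close>

text \<open>
  Linearity is only asked on a set: the Taylor orders are understood only on the terms of \<open>\<T>\<^sub>q\<close>,
  not on terms whose index is an arbitrary list.
\<close>

definition strict_order_on :: "'a set \<Rightarrow> ('a \<Rightarrow> 'a \<Rightarrow> bool) \<Rightarrow> bool" where
  "strict_order_on A prec \<longleftrightarrow> asymp_on A prec \<and> transp_on A prec \<and> totalp_on A prec"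

lemma finite_fterms: "finite (fterms f)"
proof -
  have "fterms f \<subseteq> (\<Union>b\<in>Poly_Mapping.keys f. Poly_Mapping.keys (Poly_Mapping.lookup f b) \<times> {b})"
    by (auto simp: fterms_def in_keys_iff)
  then show ?thesis
    by (rule finite_subset) auto
qed

lemma fterms_eq_empty_iff: "fterms f = {} \<longleftrightarrow> f = 0"
proof
  assume "fterms f = {}"
  then show "f = 0"
    by (auto simp: fterms_def intro!: poly_mapping_eqI)
qed (simp add: fterms_def)

lemma fterms_free_module: "f \<in> free_module B \<Longrightarrow> fterms f \<subseteq> UNIV \<times> B"
proof
  fix w assume f: "f \<in> free_module B" and "w \<in> fterms f"
  then obtain s b where w: "w = (s, b)" "Poly_Mapping.lookup (Poly_Mapping.lookup f b) s \<noteq> 0"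
    by (auto simp: fterms_def)
  then have "b \<in> Poly_Mapping.keys f" by (metis in_keys_iff lookup_zero)
  with f show "w \<in> UNIV \<times> B" by (auto simp: free_module_def w)
qed

lemma lt_eqI:
  assumes ord: "strict_order_on (UNIV \<times> B) prec" and f: "f \<in> free_module B"
    and u: "u \<in> fterms f" and max: "\<And>w. w \<in> fterms f \<Longrightarrow> w \<noteq> u \<Longrightarrow> prec w u"
  shows "lt prec f = u"
  unfolding lt_def
proof (rule the_equality)
  show "u \<in> fterms f \<and> (\<forall>w\<in>fterms f. w \<noteq> u \<longrightarrow> prec w u)"
    using u max by blast
next
  fix v assume v: "v \<in> fterms f \<and> (\<forall>w\<in>fterms f. w \<noteq> v \<longrightarrow> prec w v)"
  have "u \<in> UNIV \<times> B" "v \<in> UNIV \<times> B"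
    using fterms_free_module[OF f] u v by blast+
  moreover have "asymp_on (UNIV \<times> B) prec" using ord by (simp add: strict_order_on_def)
  ultimately have "\<not> (prec u v \<and> prec v u)" by (blast dest: asymp_onD)
  then show "v = u" using max u v by metis
qed

lemma lt_greatest:
  assumes ord: "strict_order_on (UNIV \<times> B) prec" and f: "f \<in> free_module B" and "f \<noteq> 0"
  shows "lt prec f \<in> fterms f" and "\<And>w. w \<in> fterms f \<Longrightarrow> w \<noteq> lt prec f \<Longrightarrow> prec w (lt prec f)"
proof -
  have sub: "fterms f \<subseteq> UNIV \<times> B" by (rule fterms_free_module[OF f])
  have "\<exists>u\<in>fterms f. \<forall>w\<in>fterms f. w \<noteq> u \<longrightarrow> prec w u"
  proof (rule Finite_Set.bex_greatest_element)
    show "transp_on (fterms f) prec" "totalp_on (fterms f) prec"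
      using ord sub transp_on_subset totalp_on_subset unfolding strict_order_on_def by metis+
  qed (use assms(3) in \<open>simp_all add: finite_fterms fterms_eq_empty_iff\<close>)
  then obtain u where u: "u \<in> fterms f" "\<And>w. w \<in> fterms f \<Longrightarrow> w \<noteq> u \<Longrightarrow> prec w u"
    by blast
  then have "lt prec f = u" by (intro lt_eqI[OF ord f])
  then show "lt prec f \<in> fterms f" "\<And>w. w \<in> fterms f \<Longrightarrow> w \<noteq> lt prec f \<Longrightarrow> prec w (lt prec f)"
    using u by blast+
qed

section \<open>Increasing sequences\<close>

text \<open>
  Both arrangements are treated at once by singling out the entry that the leading term of
  \<open>\<delta> v\<^sub>k\<close> removes: the first entry in the descending and the last entry in the ascending case.
  \<open>pcons d x k\<close> adjoins such an entry \<open>x\<close>, and \<open>before d x y\<close> says that \<open>x\<close> lies on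
  the adjoining side of \<open>y\<close>.
\<close>

definition pcons :: "arrangement \<Rightarrow> nat \<Rightarrow> nat list \<Rightarrow> nat list" where
  "pcons d x k = (case d of Descending \<Rightarrow> x # k | Ascending \<Rightarrow> k @ [x])"

definition before :: "arrangement \<Rightarrow> nat \<Rightarrow> nat \<Rightarrow> bool" where
  "before d x y = (case d of Descending \<Rightarrow> x < y | Ascending \<Rightarrow> y < x)"

text \<open>
  The comparison of indices that decides between terms whose images have equal leading terms;
  generators are always numbered against it.
\<close>

definition tiebreak :: "arrangement \<Rightarrow> nat list \<Rightarrow> nat list \<Rightarrow> bool" where
  "tiebreak d k l = (case d of Descending \<Rightarrow> seq_less k l | Ascending \<Rightarrow> seq_less l k)"

text \<open>
  The order on indices that results when the recursion for \<open>\<prec>\<^sub>q\<close> is followed down to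
  \<open>q = 0\<close>: entries are compared starting from the end opposite to the adjoined one.
\<close>

definition seq_prec :: "arrangement \<Rightarrow> nat list \<Rightarrow> nat list \<Rightarrow> bool" where
  "seq_prec d k l = (case d of Descending \<Rightarrow> seq_less (rev k) (rev l) | Ascending \<Rightarrow> seq_less l k)"

lemma set_pcons [simp]: "set (pcons d x k) = insert x (set k)"
  by (cases d) (auto simp: pcons_def)

lemma length_pcons [simp]: "length (pcons d x k) = Suc (length k)"
  by (cases d) (auto simp: pcons_def)

lemma pcons_inject [simp]: "pcons d x k = pcons d y l \<longleftrightarrow> x = y \<and> k = l"
  by (cases d) (auto simp: pcons_def)

lemma removeAll_pcons:
  "removeAll y (pcons d x k) = (if x = y then removeAll y k else pcons d x (removeAll y k))"
  by (cases d) (auto simp: pcons_def)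

lemma before_irrefl [simp]: "\<not> before d x x"
  by (cases d) (auto simp: before_def)

lemma before_trans: "before d x y \<Longrightarrow> before d y z \<Longrightarrow> before d x z"
  by (cases d) (auto simp: before_def)

lemma seq_less_irrefl [simp]: "\<not> seq_less k k"
  by (induction k) (auto simp: seq_less_def)

lemma seq_less_trans: "seq_less x y \<Longrightarrow> seq_less y z \<Longrightarrow> seq_less x z"
  using lex_transI[of less_than] unfolding seq_less_def by (meson trans_less_than transD)

lemma seq_less_total: "length k = length l \<Longrightarrow> k \<noteq> l \<Longrightarrow> seq_less k l \<or> seq_less l k"
  by (induction k l rule: list_induct2) (auto simp: seq_less_def)

lemma seq_less_snoc:
  "length xs = length ys \<Longrightarrow> seq_less (xs @ [x]) (ys @ [y]) \<longleftrightarrow> seq_less xs ys \<or> xs = ys \<and> x < y"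
  by (induction xs ys rule: list_induct2) (auto simp: seq_less_def)

lemma seq_prec_irrefl [simp]: "\<not> seq_prec d k k"
  by (cases d) (auto simp: seq_prec_def)

lemma seq_prec_trans: "seq_prec d x y \<Longrightarrow> seq_prec d y z \<Longrightarrow> seq_prec d x z"
  by (cases d) (auto simp: seq_prec_def intro: seq_less_trans)

lemma seq_prec_total: "length k = length l \<Longrightarrow> k \<noteq> l \<Longrightarrow> seq_prec d k l \<or> seq_prec d l k"
  using seq_less_total[of k l] seq_less_total[of "rev k" "rev l"]
  by (cases d) (auto simp: seq_prec_def)

text \<open>
  One step of the recursion: first the indices of the leading terms are compared, then, if they
  agree, the entries that were removed.
\<close>

lemma seq_prec_pcons:
  "length k = length l \<Longrightarrow>
     seq_prec d (pcons d x k) (pcons d y l) \<longleftrightarrow> seq_prec d k l \<or> k = l \<and> before d x y"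
  by (cases d) (auto simp: seq_prec_def pcons_def before_def seq_less_snoc)

lemma tiebreak_pcons: "tiebreak d (pcons d x k) (pcons d y k) \<longleftrightarrow> before d x y"
proof (cases d)
  case Descending
  then show ?thesis
    using seq_less_irrefl[of k, unfolded seq_less_def]
    by (auto simp: tiebreak_def pcons_def before_def seq_less_def)
next
  case Ascending
  then show ?thesis by (simp add: tiebreak_def pcons_def before_def seq_less_snoc)
qed

lemma pcons_in_seqs:
  "pcons d x k \<in> seqs r (Suc q) \<longleftrightarrow> x \<in> {1..r} \<and> k \<in> seqs r q \<and> (\<forall>y\<in>set k. before d x y)"
  by (cases d) (auto simp: pcons_def seqs_def before_def sorted_wrt_append)

lemma seqs_Suc_cases:
  assumes "k \<in> seqs r (Suc q)"
  obtains x n where "k = pcons d x n" "x \<in> {1..r}" "n \<in> seqs r q" "\<And>y. y \<in> set n \<Longrightarrow> before d x y"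
proof -
  have "k \<noteq> []" using assms by (auto simp: seqs_def)
  then have "\<exists>x n. k = pcons d x n"
    by (cases d) (auto simp: pcons_def neq_Nil_conv intro: append_butlast_last_id[symmetric])
  then show thesis using that assms pcons_in_seqs by blast
qed

lemma finite_seqs: "finite (seqs r q)"
proof -
  have "seqs r q \<subseteq> {k. set k \<subseteq> {1..r} \<and> length k = q}"
    by (auto simp: seqs_def)
  then show ?thesis
    by (rule finite_subset) (simp add: finite_lists_length_eq)
qed

lemma seqs_sorted: "k \<in> seqs r q \<Longrightarrow> sorted_wrt (<) k"
  by (simp add: seqs_def)

lemma seqs_length: "k \<in> seqs r q \<Longrightarrow> length k = q"
  by (simp add: seqs_def)

lemma seqs_0: "seqs r 0 = {[]}"
  by (auto simp: seqs_def)

lemma distinct_if_sorted: "sorted_wrt (<) (k :: nat list) \<Longrightarrow> distinct k"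
  by (simp add: strict_sorted_iff)

lemma sorted_removeAll: "sorted_wrt (<) (k :: nat list) \<Longrightarrow> sorted_wrt (<) (removeAll x k)"
  by (simp add: removeAll_filter_not_eq sorted_wrt_filter)

lemma removeAll_in_seqs:
  assumes "k \<in> seqs r (Suc q)" "x \<in> set k"
  shows "removeAll x k \<in> seqs r q"
proof -
  have "length (removeAll x k) = q"
    using assms distinct_if_sorted[of k]
    by (auto simp: seqs_def distinct_remove1_removeAll[symmetric] length_remove1)
  then show ?thesis
    using assms by (auto simp: seqs_def sorted_removeAll)
qed

lemma removeAll_inject: "removeAll x k = removeAll y k \<Longrightarrow> x \<in> set k \<Longrightarrow> x = y"
  by (metis Diff_iff set_removeAll singletonD singletonI)

lemma removeAll_commute: "removeAll x (removeAll y k) = removeAll y (removeAll x k)"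
  by (induction k) auto

lemma removeAll_absent_pcons:
  assumes "pcons d x n \<in> seqs r (Suc q)"
  shows "removeAll x (pcons d x n) = n"
  using assms by (auto simp: removeAll_pcons pcons_in_seqs intro!: removeAll_id)

text \<open>
  Among all sequences obtained from \<open>pcons d x n\<close> by removing one entry, \<open>n\<close> is the
  largest: keeping \<open>x\<close> and removing another entry moves an entry in the direction of
  \<open>before\<close> at the first place where the result differs from \<open>n\<close>.
\<close>

lemma seq_prec_removeAll:
  assumes "pcons d x n \<in> seqs r (Suc q)" "y \<in> set n"
  shows "seq_prec d (pcons d x (removeAll y n)) n"
  using assms
proof (induction q arbitrary: x n)
  case 0
  then show ?case by (auto simp: pcons_in_seqs seqs_0)
next
  case (Suc q)
  have n: "n \<in> seqs r (Suc q)" "\<And>z. z \<in> set n \<Longrightarrow> before d x z"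
    using Suc.prems by (auto simp: pcons_in_seqs)
  obtain z n' where z: "n = pcons d z n'" "n' \<in> seqs r q" "\<And>y. y \<in> set n' \<Longrightarrow> before d z y"
    using seqs_Suc_cases[OF n(1)] by metis
  show ?case
  proof (cases "y = z")
    case True
    then have "removeAll y n = n'" using removeAll_absent_pcons n(1) z(1) by metis
    then show ?thesis using n(2)[of z] by (simp add: z(1) seq_prec_pcons)
  next
    case False
    then have y: "y \<in> set n'" using Suc.prems(2) z(1) by simp
    have "seq_prec d (pcons d z (removeAll y n')) n'"
      using Suc.IH[of z n'] n(1) y unfolding z(1) by simp
    moreover have "length (pcons d z (removeAll y n')) = length n'"
      using seqs_length[OF removeAll_in_seqs[OF n(1) Suc.prems(2)]] False seqs_length[OF z(2)]
      by (simp add: removeAll_pcons z(1))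
    ultimately show ?thesis
      using False by (simp add: z(1) removeAll_pcons seq_prec_pcons)
  qed
qed

section \<open>The Taylor complex\<close>

interpretation fmod: module "fscale :: ('n, 'k::field) mpoly \<Rightarrow> ('b, 'n, 'k) fmod \<Rightarrow> _"
  by (rule module_fscale)

lemma fscale_single: "fscale p (Poly_Mapping.single b c) = Poly_Mapping.single b (p * c)"
  by (intro poly_mapping_eqI) (simp add: lookup_fscale lookup_single when_def)

text \<open>
  The sign \<open>(-1)\<^bsup>\<ell>-1\<^esup>\<close> of the summand of \<open>\<delta> v\<^sub>k\<close> that removes \<open>x = k\<^sub>\<ell>\<close>. Indexing the
  summands by the removed entry instead of its position makes removals commute.
\<close>

definition pos_sign :: "nat list \<Rightarrow> nat \<Rightarrow> 'k::field" where
  "pos_sign k x = (-1) ^ card {y \<in> set k. y < x}"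

lemma pos_sign_neq_0 [simp]: "pos_sign k x \<noteq> 0"
  by (simp add: pos_sign_def)

lemma pos_sign_inverse: "1 / (pos_sign k x :: 'k::field) = pos_sign k x"
  by (simp add: pos_sign_def power_minus1_even uminus_power_if)

lemma pos_sign_removeAll_less:
  assumes "x \<in> set k" "x < y"
  shows "(pos_sign (removeAll x k) y :: 'k::field) = - pos_sign k y"
proof -
  have "{z \<in> set k. z < y} = insert x {z \<in> set (removeAll x k). z < y}"
    using assms by auto
  moreover have "card (insert x {z \<in> set (removeAll x k). z < y}) = Suc (card {z \<in> set (removeAll x k). z < y})"
    by (intro card_insert_disjoint) auto
  ultimately show ?thesis by (simp add: pos_sign_def)
qed

lemma pos_sign_removeAll_not_less:
  assumes "\<not> x < y"
  shows "(pos_sign (removeAll x k) y :: 'k::field) = pos_sign k y"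
proof -
  have "{z \<in> set k. z < y} = {z \<in> set (removeAll x k). z < y}"
    using assms by auto
  then show ?thesis by (simp add: pos_sign_def)
qed

text \<open>
  Removing two entries in one order or the other gives opposite signs, because removing the smaller
  one first shifts the position of the larger one by one.
\<close>

lemma pos_sign_swap:
  assumes "x \<in> set k" "y \<in> set k" "x \<noteq> y"
  shows "(pos_sign k y * pos_sign (removeAll y k) x :: 'k::field) = - (pos_sign k x * pos_sign (removeAll x k) y)"
proof (cases "x < y")
  case True
  then show ?thesis
    using pos_sign_removeAll_less[OF assms(1), of y, where 'k = 'k] pos_sign_removeAll_not_less[of y x k, where 'k = 'k]
    by (simp add: mult.commute)
next
  case False
  then show ?thesis
    using assms(3) pos_sign_removeAll_less[OF assms(2), of x, where 'k = 'k] pos_sign_removeAll_not_less[of x y k, where 'k = 'k]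
    by (simp add: mult.commute)
qed

lemma delta_basis_eq:
  assumes "sorted_wrt (<) k"
  shows "(delta_basis m k :: (nat list, 'n, 'k::field) fmod) = (\<Sum>x\<in>set k. Poly_Mapping.single (removeAll x k)
     (Poly_Mapping.single (lcm_seq m k - lcm_seq m (removeAll x k)) (pos_sign k x)))"
proof -
  have k: "distinct k" by (rule distinct_if_sorted[OF assms])
  have drop: "drop_entry (Suc i) k = removeAll (k ! i) k"
    and card: "card {y \<in> set k. y < k ! i} = i" if "i < length k" for i
  proof -
    have split: "k = take i k @ k ! i # drop (Suc i) k"
      by (rule id_take_nth_drop[OF that])
    have "k ! i \<notin> set (take i k)" "k ! i \<notin> set (drop (Suc i) k)"
      using k split by (metis distinct_append distinct.simps(2) disjoint_iff list.set_intros(1))+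
    then have "removeAll (k ! i) (take i k @ k ! i # drop (Suc i) k) = take i k @ drop (Suc i) k"
      by simp
    then show "drop_entry (Suc i) k = removeAll (k ! i) k"
      using split by (simp add: drop_entry_def)
    have "sorted_wrt (<) (take i k @ k ! i # drop (Suc i) k)"
      using assms split by simp
    then have "{y \<in> set (take i k @ k ! i # drop (Suc i) k). y < k ! i} = set (take i k)"
      by (force simp: sorted_wrt_append)
    then have "{y \<in> set k. y < k ! i} = set (take i k)"
      using split by metis
    then show "card {y \<in> set k. y < k ! i} = i"
      using k that by (simp add: distinct_card)
  qed
  have "bij_betw ((!) k) {..<length k} (set k)"
    using bij_betw_nth[OF k, of "{..<length k}" "set k"] by simp
  then have "(\<Sum>x\<in>set k. Poly_Mapping.single (removeAll x k)
     (Poly_Mapping.single (lcm_seq m k - lcm_seq m (removeAll x k)) (pos_sign k x :: 'k)))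
   = (\<Sum>i<length k. Poly_Mapping.single (removeAll (k ! i) k)
     (Poly_Mapping.single (lcm_seq m k - lcm_seq m (removeAll (k ! i) k)) (pos_sign k (k ! i))))"
    by (rule sum.reindex_bij_betw[symmetric])
  also have "\<dots> = (\<Sum>i<length k. Poly_Mapping.single (drop_entry (Suc i) k)
     (Poly_Mapping.single (lcm_seq m k - lcm_seq m (drop_entry (Suc i) k)) ((-1) ^ i)))"
    by (intro sum.cong) (simp_all add: drop card pos_sign_def)
  also have "\<dots> = delta_basis m k"
    unfolding delta_basis_def
    by (rule sum.reindex_bij_witness[of _ "\<lambda>i. i - 1" Suc]) auto
  finally show ?thesis ..
qed

lemma lookup_delta_basis_removeAll:
  assumes "sorted_wrt (<) k" "x \<in> set k"
  shows "Poly_Mapping.lookup (delta_basis m k :: (nat list, 'n, 'k::field) fmod) (removeAll x k)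
     = Poly_Mapping.single (lcm_seq m k - lcm_seq m (removeAll x k)) (pos_sign k x)"
proof -
  have "Poly_Mapping.lookup (delta_basis m k :: (nat list, 'n, 'k::field) fmod) (removeAll x k)
     = (\<Sum>y\<in>set k. if y = x then Poly_Mapping.single (lcm_seq m k - lcm_seq m (removeAll x k)) (pos_sign k x) else 0)"
    unfolding delta_basis_eq[OF assms(1)] lookup_sum
    by (intro sum.cong refl) (auto simp: lookup_single when_def dest: removeAll_inject)
  then show ?thesis using assms(2) by simp
qed

lemma lookup_delta_basis_neq_0:
  assumes "sorted_wrt (<) k"
    and "Poly_Mapping.lookup (delta_basis m k :: (nat list, 'n, 'k::field) fmod) n \<noteq> 0"
  obtains x where "x \<in> set k" "n = removeAll x k"
proof -
  have "\<exists>x\<in>set k. n = removeAll x k"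
  proof (rule ccontr)
    assume "\<not> ?thesis"
    then have "Poly_Mapping.lookup (delta_basis m k :: (nat list, 'n, 'k::field) fmod) n = 0"
      unfolding delta_basis_eq[OF assms(1)] lookup_sum
      by (intro sum.neutral) (auto simp: lookup_single when_def)
    with assms(2) show False by simp
  qed
  then show thesis using that by blast
qed

lemma delta_eq_sum:
  assumes "finite A" "Poly_Mapping.keys f \<subseteq> A"
  shows "delta m f = (\<Sum>k\<in>A. fscale (Poly_Mapping.lookup f k) (delta_basis m k))"
  unfolding delta_def
  by (rule sum.mono_neutral_left[OF assms]) (auto simp: in_keys_iff)

lemma delta_add: "delta m (f + g) = delta m f + delta m g"
proof -
  let ?A = "Poly_Mapping.keys f \<union> Poly_Mapping.keys g"
  have "Poly_Mapping.keys (f + g) \<subseteq> ?A" by (rule keys_add)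
  then show ?thesis
    by (simp add: delta_eq_sum[of ?A] lookup_add fmod.scale_left_distrib sum.distrib)
qed

lemma delta_fscale: "delta m (fscale p f) = fscale p (delta m f)"
proof -
  have "Poly_Mapping.keys (fscale p f) \<subseteq> Poly_Mapping.keys f"
    by (auto simp: in_keys_iff lookup_fscale)
  then show ?thesis
    by (simp add: delta_eq_sum[of "Poly_Mapping.keys f"] lookup_fscale fmod.scale_sum_right)
qed

lemma delta_0 [simp]: "delta m 0 = 0"
  by (simp add: delta_def)

lemma delta_single: "delta m (Poly_Mapping.single k p) = fscale p (delta_basis m k)"
  by (subst delta_eq_sum[of "{k}"]) (auto simp: lookup_single)

lemma delta_sum: "delta m (\<Sum>i\<in>A. f i) = (\<Sum>i\<in>A. delta m (f i))"
  by (induction A rule: infinite_finite_induct) (simp_all add: delta_add)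

text \<open>
  The summand at \<open>(x, y)\<close> is matched with the one at \<open>(y, x)\<close> instead of showing that the sum
  equals its negative, so that the argument also covers characteristic two.
\<close>

lemma sum_antisymmetric_eq_0:
  fixes F :: "'a::linorder \<Rightarrow> 'a \<Rightarrow> 'b::ab_group_add"
  assumes "finite A" and anti: "\<And>x y. x \<in> A \<Longrightarrow> y \<in> A \<Longrightarrow> x < y \<Longrightarrow> F y x = - F x y"
  shows "(\<Sum>x\<in>A. \<Sum>y\<in>A - {x}. F x y) = 0"
proof -
  let ?L = "{(x, y) \<in> A \<times> A. x < y}" and ?U = "{(x, y) \<in> A \<times> A. y < x}"
  have fin: "finite ?L" "finite ?U"
    by (rule finite_subset[of _ "A \<times> A"]; use assms(1) in auto)+
  have "(\<Sum>x\<in>A. \<Sum>y\<in>A - {x}. F x y) = (\<Sum>(x, y)\<in>Sigma A (\<lambda>x. A - {x}). F x y)"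
    using assms(1) by (subst sum.Sigma) auto
  also have "Sigma A (\<lambda>x. A - {x}) = ?L \<union> ?U" by auto
  also have "(\<Sum>(x, y)\<in>?L \<union> ?U. F x y) = (\<Sum>(x, y)\<in>?L. F x y) + (\<Sum>(x, y)\<in>?U. F x y)"
    by (rule sum.union_disjoint[OF fin]) auto
  also have "(\<Sum>(x, y)\<in>?U. F x y) = (\<Sum>(x, y)\<in>?L. F y x)"
    by (rule sum.reindex_bij_witness[of _ prod.swap prod.swap]) auto
  also have "\<dots> = - (\<Sum>(x, y)\<in>?L. F x y)"
    unfolding sum_negf[symmetric] by (intro sum.cong refl) (auto simp: anti)
  finally show ?thesis by simp
qed

text \<open>
  Each pair of entries \<open>x \<noteq> y\<close> contributes two terms with the same index and, as quotients of
  lcms compose, the same monomial; their signs are opposite.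
\<close>

lemma delta_delta_basis:
  assumes "sorted_wrt (<) k"
  shows "delta m (delta_basis m k :: (nat list, 'n, 'k::field) fmod) = 0"
proof -
  let ?m = "lcm_seq m"
  define F :: "nat \<Rightarrow> nat \<Rightarrow> (nat list, 'n, 'k) fmod" where
    "F x y = Poly_Mapping.single (removeAll y (removeAll x k))
       (Poly_Mapping.single (?m k - ?m (removeAll y (removeAll x k)))
         (pos_sign k x * pos_sign (removeAll x k) y))" for x y
  have "delta m (delta_basis m k :: (nat list, 'n, 'k) fmod)
      = (\<Sum>x\<in>set k. fscale (Poly_Mapping.single (?m k - ?m (removeAll x k)) (pos_sign k x))
           (delta_basis m (removeAll x k)))"
    unfolding delta_basis_eq[OF assms] delta_sum delta_single ..
  also have "\<dots> = (\<Sum>x\<in>set k. \<Sum>y\<in>set k - {x}. F x y)"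
  proof (intro sum.cong refl)
    fix x assume "x \<in> set k"
    have "?m k - ?m (removeAll x k) + (?m (removeAll x k) - ?m (removeAll y (removeAll x k)))
        = ?m k - ?m (removeAll y (removeAll x k))" for y
      by (intro mon_quotient_trans lcm_seq_mono) auto
    then show "fscale (Poly_Mapping.single (?m k - ?m (removeAll x k)) (pos_sign k x))
           (delta_basis m (removeAll x k)) = (\<Sum>y\<in>set k - {x}. F x y)"
      by (simp add: delta_basis_eq[OF sorted_removeAll[OF assms]] fmod.scale_sum_right fscale_single mult_single F_def)
  qed
  also have "\<dots> = 0"
  proof (rule sum_antisymmetric_eq_0)
    fix x y assume "x \<in> set k" "y \<in> set k" "x < y"
    then show "F y x = - F x y"
      unfolding F_def
      by (simp add: pos_sign_swap[of x k y] removeAll_commute[of x y] single_uminus)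
  qed simp
  finally show ?thesis .
qed

lemma delta_basis_in_free_module:
  assumes "k \<in> seqs r (Suc q)"
  shows "(delta_basis m k :: (nat list, 'n, 'k::field) fmod) \<in> free_module (seqs r q)"
proof -
  have "n \<in> seqs r q" if "n \<in> Poly_Mapping.keys (delta_basis m k :: (nat list, 'n, 'k) fmod)" for n
    using that lookup_delta_basis_neq_0[OF seqs_sorted[OF assms], of m n] removeAll_in_seqs[OF assms]
    by (metis in_keys_iff)
  then show ?thesis by (auto simp: free_module_def)
qed

section \<open>The term orders in closed form\<close>

text \<open>
  The term \<open>s v\<^sub>k\<close> has total monomial \<open>s m\<^sub>k\<close>, and \<open>\<delta>\<close> preserves this grading. Hence
  \<open>\<prec>\<^sub>q\<close> compares total monomials by \<open>\<prec>\<^sub>0\<close> and, within one degree, indices only.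
\<close>

definition multi_less :: "arrangement \<Rightarrow> (nat \<Rightarrow> 'n mon) \<Rightarrow> ('n mon \<Rightarrow> 'n mon \<Rightarrow> bool)
    \<Rightarrow> (nat list, 'n) fterm \<Rightarrow> (nat list, 'n) fterm \<Rightarrow> bool" where
  "multi_less d m ord = (\<lambda>(s, k) (t, l).
     ord (s + lcm_seq m k) (t + lcm_seq m l) \<or>
     s + lcm_seq m k = t + lcm_seq m l \<and> seq_prec d k l)"

lemma strict_order_multi_less:
  fixes ord :: "'n mon \<Rightarrow> 'n mon \<Rightarrow> bool"
  assumes "term_order ord"
  shows "strict_order_on (UNIV \<times> seqs r q) (multi_less d m ord)"
proof -
  have irr: "\<not> ord s s" and tr: "ord s t \<Longrightarrow> ord t u \<Longrightarrow> ord s u" and tot: "s \<noteq> t \<Longrightarrow> ord s t \<or> ord t s"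
    for s t u
    using assms unfolding term_order_def by (blast dest: irreflpD transpD totalpD)+
  have trans: "multi_less d m ord u w" if "multi_less d m ord u v" "multi_less d m ord v w" for u v w
    using that by (cases u; cases v; cases w) (auto simp: multi_less_def intro: tr seq_prec_trans)
  have "\<not> multi_less d m ord u u" for u
    by (cases u) (simp add: multi_less_def irr)
  then have "asymp_on (UNIV \<times> seqs r q) (multi_less d m ord)"
    using trans by (blast intro: asymp_onI)
  moreover have "transp_on (UNIV \<times> seqs r q) (multi_less d m ord)"
    using trans by (blast intro: transp_onI)
  moreover have "totalp_on (UNIV \<times> seqs r q) (multi_less d m ord)"
  proof (rule totalp_onI)
    fix u v :: "(nat list, 'n) fterm" assume "u \<in> UNIV \<times> seqs r q" "v \<in> UNIV \<times> seqs r q" "u \<noteq> v"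
    moreover obtain s k t l where "u = (s, k)" "v = (t, l)" by (cases u; cases v)
    ultimately have "k \<noteq> l \<or> k = l \<and> s + lcm_seq m k \<noteq> t + lcm_seq m l" "length k = length l"
      by (auto simp: seqs_length)
    then show "multi_less d m ord u v \<or> multi_less d m ord v u"
      using tot[of "s + lcm_seq m k" "t + lcm_seq m l"] seq_prec_total[of k l d]
      unfolding \<open>u = (s, k)\<close> \<open>v = (t, l)\<close> multi_less_def prod.case by metis
  qed
  ultimately show ?thesis by (simp add: strict_order_on_def)
qed

lemma strict_order_on_cong:
  assumes "strict_order_on A Q" "\<And>x y. x \<in> A \<Longrightarrow> y \<in> A \<Longrightarrow> P x y \<longleftrightarrow> Q x y"
  shows "strict_order_on A P"
proof -
  have "asymp_on A P"
    using assms unfolding strict_order_on_def by (intro asymp_onI) (auto dest: asymp_onD)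
  moreover have "transp_on A P"
    using assms unfolding strict_order_on_def by (intro transp_onI) (auto dest: transp_onD)
  moreover have "totalp_on A P"
    using assms unfolding strict_order_on_def by (intro totalp_onI) (auto dest: totalp_onD)
  ultimately show ?thesis by (simp add: strict_order_on_def)
qed

text \<open>
  No two summands of \<open>\<delta> v\<^sub>k\<close> share an index, so nothing cancels.
\<close>

lemma fterms_multiple_delta_basis:
  assumes k: "sorted_wrt (<) k" and c: "c \<noteq> 0"
  shows "fterms (fscale (Poly_Mapping.single u c) (delta_basis m k :: (nat list, 'n, 'k::field) fmod))
     = (\<lambda>x. (u + (lcm_seq m k - lcm_seq m (removeAll x k)), removeAll x k)) ` set k"
    (is "?L = ?R")
proof (rule set_eqI)
  fix w :: "(nat list, 'n) fterm"
  obtain s n where w: "w = (s, n)" by (cases w)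
  have mult: "Poly_Mapping.lookup (fscale (Poly_Mapping.single u c) (delta_basis m k)) (removeAll x k)
      = Poly_Mapping.single (u + (lcm_seq m k - lcm_seq m (removeAll x k))) (c * pos_sign k x)"
    if "x \<in> set k" for x
    by (simp add: lookup_fscale lookup_delta_basis_removeAll[OF k that] mult_single)
  show "w \<in> ?L \<longleftrightarrow> w \<in> ?R"
  proof
    assume L: "w \<in> ?L"
    then have "Poly_Mapping.lookup (delta_basis m k :: (nat list, 'n, 'k::field) fmod) n \<noteq> 0"
      by (auto simp: w fterms_def lookup_fscale)
    then obtain x where x: "x \<in> set k" "n = removeAll x k"
      using lookup_delta_basis_neq_0[OF k] by metis
    with L show "w \<in> ?R"
      by (auto simp: w fterms_def mult lookup_single when_def split: if_splits)
  next
    assume "w \<in> ?R"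
    then show "w \<in> ?L"
      by (auto simp: w fterms_def mult c)
  qed
qed

lemma fscale_in_free_module: "f \<in> free_module B \<Longrightarrow> fscale p f \<in> free_module B"
  by (auto simp: free_module_def in_keys_iff lookup_fscale subset_iff) (metis mult_zero_right)

text \<open>
  All terms of a multiple of \<open>\<delta> v\<^sub>k\<close> have the same total monomial, so the largest one is the
  one with the largest index, which arises by removing the adjoined entry. The order enters only
  through its values on \<open>\<T>\<^sub>q\<close> because this lemma is itself a step in the induction that
  identifies \<open>\<prec>\<^sub>q\<close> there.
\<close>

lemma lt_multiple_delta_basis:
  fixes c :: "'k::field"
  assumes ord: "term_order ord"
    and prec: "\<And>u w. u \<in> UNIV \<times> seqs r q \<Longrightarrow> w \<in> UNIV \<times> seqs r q \<Longrightarrow> prec u w \<longleftrightarrow> multi_less d m ord u w"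
    and k: "pcons d x n \<in> seqs r (Suc q)" and c: "c \<noteq> 0"
  shows "lt prec (fscale (Poly_Mapping.single u c) (delta_basis m (pcons d x n)))
    = (u + (lcm_seq m (pcons d x n) - lcm_seq m n), n)"
proof (rule lt_eqI)
  let ?k = "pcons d x n"
  let ?f = "fscale (Poly_Mapping.single u c) (delta_basis m ?k)"
  show "strict_order_on (UNIV \<times> seqs r q) prec"
    by (rule strict_order_on_cong[OF strict_order_multi_less[OF ord, of r q d m] prec])
  show f: "?f \<in> free_module (seqs r q)"
    by (intro fscale_in_free_module delta_basis_in_free_module k)
  note terms = fterms_multiple_delta_basis[OF seqs_sorted[OF k] c, of u m]
  show lead: "(u + (lcm_seq m ?k - lcm_seq m n), n) \<in> fterms ?f"
    unfolding terms by (rule image_eqI[of _ _ x]) (simp_all add: removeAll_absent_pcons[OF k])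
  fix w assume w: "w \<in> fterms ?f" and neq: "w \<noteq> (u + (lcm_seq m ?k - lcm_seq m n), n)"
  then obtain y where y: "y \<in> set ?k"
    and w_eq: "w = (u + (lcm_seq m ?k - lcm_seq m (removeAll y ?k)), removeAll y ?k)"
    unfolding terms by blast
  then have "y \<noteq> x" using neq removeAll_absent_pcons[OF k] by auto
  then have "seq_prec d (removeAll y ?k) n"
    using seq_prec_removeAll[OF k] y by (simp add: removeAll_pcons)
  moreover have "u + (lcm_seq m ?k - lcm_seq m l) + lcm_seq m l = u + lcm_seq m ?k"
    if "set l \<subseteq> set ?k" for l
    using mon_dvd_diff_add[OF lcm_seq_mono[OF that, of m]] by (simp add: add.assoc)
  then have "u + (lcm_seq m ?k - lcm_seq m (removeAll y ?k)) + lcm_seq m (removeAll y ?k) = u + lcm_seq m ?k"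
    "u + (lcm_seq m ?k - lcm_seq m n) + lcm_seq m n = u + lcm_seq m ?k"
    by auto
  ultimately have "multi_less d m ord w (u + (lcm_seq m ?k - lcm_seq m n), n)"
    unfolding w_eq multi_less_def by simp
  then show "prec w (u + (lcm_seq m ?k - lcm_seq m n), n)"
    using prec fterms_free_module[OF f] w lead by blast
qed

text \<open>
  The total monomial of the leading term of \<open>s \<delta> v\<^sub>k\<close> is again \<open>s m\<^sub>k\<close>, and its index is
  \<open>k\<close> without the adjoined entry; so comparing leading terms and then breaking ties is one step
  of \<open>seq_prec\<close>.
\<close>

lemma taylor_less_iff:
  fixes m :: "nat \<Rightarrow> 'n mon"
  assumes ord: "term_order ord"
  shows "k \<in> seqs r q \<Longrightarrow> l \<in> seqs r q \<Longrightarrow>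
    taylor_less TYPE('k::field) d m ord q (s, k) (t, l) \<longleftrightarrow> multi_less d m ord (s, k) (t, l)"
proof (induction q arbitrary: s t k l)
  case 0
  then show ?case by (simp add: seqs_0 multi_less_def lcm_seq_def)
next
  case (Suc q)
  let ?prec = "taylor_less TYPE('k) d m ord q"
  obtain x n where k: "k = pcons d x n" "n \<in> seqs r q" using seqs_Suc_cases[OF Suc.prems(1)] by metis
  obtain y n' where l: "l = pcons d y n'" "n' \<in> seqs r q" using seqs_Suc_cases[OF Suc.prems(2)] by metis
  have prec: "?prec u w \<longleftrightarrow> multi_less d m ord u w" if "u \<in> UNIV \<times> seqs r q" "w \<in> UNIV \<times> seqs r q" for u w
    using that Suc.IH by (cases u; cases w) simp
  have dvd: "mon_dvd (lcm_seq m n) (lcm_seq m k)" "mon_dvd (lcm_seq m n') (lcm_seq m l)"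
    by (intro lcm_seq_mono; force simp: k l)+
  have lt: "lt ?prec (fscale (Poly_Mapping.single s 1) (delta_basis m k :: (nat list, 'n, 'k) fmod))
      = (s + (lcm_seq m k - lcm_seq m n), n)"
    "lt ?prec (fscale (Poly_Mapping.single t 1) (delta_basis m l :: (nat list, 'n, 'k) fmod))
      = (t + (lcm_seq m l - lcm_seq m n'), n')"
    using lt_multiple_delta_basis[OF ord prec, where c = "1 :: 'k"] Suc.prems unfolding k l by simp_all
  have total: "s + (lcm_seq m k - lcm_seq m n) + lcm_seq m n = s + lcm_seq m k"
     "t + (lcm_seq m l - lcm_seq m n') + lcm_seq m n' = t + lcm_seq m l"
    using dvd by (simp_all add: add.assoc mon_dvd_diff_add)
  have "taylor_less TYPE('k) d m ord (Suc q) (s, k) (t, l) \<longleftrightarrow>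
      multi_less d m ord (s + (lcm_seq m k - lcm_seq m n), n) (t + (lcm_seq m l - lcm_seq m n'), n') \<or>
      s + (lcm_seq m k - lcm_seq m n) = t + (lcm_seq m l - lcm_seq m n') \<and> n = n' \<and> tiebreak d k l"
    using prec k(2) l(2) by (simp add: lt tiebreak_def)
  also have "\<dots> \<longleftrightarrow> ord (s + lcm_seq m k) (t + lcm_seq m l) \<or>
      s + lcm_seq m k = t + lcm_seq m l \<and> (seq_prec d n n' \<or> n = n' \<and> before d x y)"
  proof (cases "n = n'")
    case True
    have "s + (lcm_seq m k - lcm_seq m n) = t + (lcm_seq m l - lcm_seq m n') \<longleftrightarrow>
      s + lcm_seq m k = t + lcm_seq m l"
      unfolding total[symmetric] True by simp
    then show ?thesis
      using total True tiebreak_pcons[of d x n y] by (auto simp: multi_less_def k l)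
  next
    case False
    then show ?thesis
      using total by (simp add: multi_less_def)
  qed
  also have "\<dots> \<longleftrightarrow> multi_less d m ord (s, k) (t, l)"
    using seqs_length[OF k(2)] seqs_length[OF l(2)] by (simp add: multi_less_def k(1) l(1) seq_prec_pcons)
  finally show ?case .
qed

lemma strict_order_taylor_less:
  assumes "term_order ord"
  shows "strict_order_on (UNIV \<times> seqs r q) (taylor_less TYPE('k::field) d m ord q)"
  by (rule strict_order_on_cong[OF strict_order_multi_less[OF assms, of r q d m]])
    (auto simp: taylor_less_iff[OF assms])

lemma lt_taylor_less_multiple:
  fixes c :: "'k::field"
  assumes ord: "term_order ord" and k: "pcons d x n \<in> seqs r (Suc q)" and c: "c \<noteq> 0"
  shows "lt (taylor_less TYPE('k) d m ord q) (fscale (Poly_Mapping.single u c) (delta_basis m (pcons d x n)))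
    = (u + (lcm_seq m (pcons d x n) - lcm_seq m n), n)"
  by (rule lt_multiple_delta_basis[OF ord _ k c]) (auto simp: taylor_less_iff[OF ord])

lemma lt_taylor_less_delta_basis:
  assumes ord: "term_order ord" and k: "pcons d x n \<in> seqs r (Suc q)"
  shows "lt (taylor_less TYPE('k::field) d m ord q) (delta_basis m (pcons d x n) :: (nat list, 'n, 'k) fmod)
    = (lcm_seq m (pcons d x n) - lcm_seq m n, n)"
proof -
  have "Poly_Mapping.single 0 1 = (1 :: ('n, 'k) mpoly)" by simp
  then show ?thesis
    using lt_taylor_less_multiple[OF assms, of "1 :: 'k" m 0] by simp
qed

section \<open>Groebner bases of the syzygy modules\<close>

lemma delta_basis_neq_0:
  assumes "k \<in> seqs r (Suc q)"
  shows "(delta_basis m k :: (nat list, 'n, 'k::field) fmod) \<noteq> 0"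
proof
  assume *: "(delta_basis m k :: (nat list, 'n, 'k) fmod) = 0"
  obtain x n where "k = pcons Ascending x n" using seqs_Suc_cases[OF assms] .
  then have "x \<in> set k" by simp
  then have "0 = (Poly_Mapping.single (lcm_seq m k - lcm_seq m (removeAll x k)) (pos_sign k x) :: ('n, 'k) mpoly)"
    using lookup_delta_basis_removeAll[OF seqs_sorted[OF assms], of x m, where 'k = 'k] unfolding * lookup_zero by simp
  then have "(0 :: 'k) = pos_sign k x" by (metis lookup_single_eq lookup_zero)
  then show False by simp
qed

text \<open>
  Let \<open>s v\<^sub>l\<close> be the leading term of a cycle \<open>f\<close> and \<open>u v\<^sub>n\<close> the leading term of
  \<open>s \<delta> v\<^sub>l\<close>. Since \<open>\<delta> f = 0\<close>, a further term \<open>t v\<^sub>k\<close> of \<open>f\<close> must contribute to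
  \<open>u v\<^sub>n\<close>. As \<open>t v\<^sub>k\<close> is smaller than \<open>s v\<^sub>l\<close>, it can only do so if \<open>n\<close> is also \<open>k\<close>
  without its adjoined entry \<open>z\<close>, and if \<open>z\<close> comes before all entries of \<open>l\<close>. Adjoining
  \<open>z\<close> to \<open>l\<close> gives a sequence \<open>p\<close> for which \<open>\<delta> v\<^sub>p\<close> has leading index \<open>l\<close>; and
  \<open>m\<^sub>p\<close> divides \<open>s m\<^sub>l\<close>, because both \<open>m\<^sub>l\<close> and \<open>m\<^sub>k\<close> divide it.
\<close>

lemma kernel_lt_divisible:
  fixes f :: "(nat list, 'n, 'k::field) fmod" and d :: arrangement
  assumes ord: "term_order ord"
    and f: "f \<in> taylor_module r (Suc q)" "f \<noteq> 0" "delta m f = 0"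
  defines "prec \<equiv> taylor_less TYPE('k) d m ord (Suc q)"
  shows "\<exists>p\<in>seqs r (Suc (Suc q)).
     term_dvd (lt prec (delta_basis m p :: (nat list, 'n, 'k) fmod)) (lt prec f)"
proof -
  let ?m = "lcm_seq m"
  have f': "f \<in> free_module (seqs r (Suc q))" using f(1) by (simp add: taylor_module_def)
  note strict = strict_order_taylor_less[OF ord, where 'k = 'k, of r "Suc q" d m, folded prec_def]
  obtain s l where sl: "lt prec f = (s, l)" by (cases "lt prec f")
  note greatest = lt_greatest[OF strict f' f(2), unfolded sl]
  have l: "l \<in> seqs r (Suc q)" using fterms_free_module[OF f'] greatest(1) by blast
  obtain x n where xn: "l = pcons d x n" "n \<in> seqs r q" "\<And>z. z \<in> set n \<Longrightarrow> before d x z"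
    using seqs_Suc_cases[OF l] by metis
  have x: "x \<in> set l" by (simp add: xn(1))
  have n: "n = removeAll x l" using removeAll_absent_pcons l xn(1) by metis
  have fl: "Poly_Mapping.lookup (Poly_Mapping.lookup f l) s \<noteq> 0"
    using greatest(1) by (simp add: fterms_def)
  then have l_key: "l \<in> Poly_Mapping.keys f" by (auto simp: in_keys_iff)
  \<comment> \<open>\<open>D v\<^sub>n\<close> is the leading term of \<open>s \<delta> v\<^sub>l\<close>, and \<open>T k\<close> is what the component of \<open>f\<close> at \<open>k\<close>
    contributes to its coefficient in \<open>\<delta> f\<close>.\<close>
  define D where "D = s + (?m l - ?m n)"
  define T where "T k = Poly_Mapping.lookup (Poly_Mapping.lookup f k *
     Poly_Mapping.lookup (delta_basis m k) n) D" for k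
  have "Poly_Mapping.lookup (Poly_Mapping.lookup (delta m f) n) D = (\<Sum>k\<in>Poly_Mapping.keys f. T k)"
    by (simp add: delta_def lookup_sum lookup_fscale T_def)
  then have "(\<Sum>k\<in>Poly_Mapping.keys f. T k) = 0" by (simp only: f(3) lookup_zero)
  moreover have "T l = Poly_Mapping.lookup (Poly_Mapping.lookup f l) s * pos_sign l x"
  proof -
    have "Poly_Mapping.lookup (delta_basis m l :: (nat list, 'n, 'k) fmod) n
        = Poly_Mapping.single (?m l - ?m n) (pos_sign l x)"
      using lookup_delta_basis_removeAll[OF seqs_sorted[OF l] x] unfolding n[symmetric] .
    then show ?thesis by (simp add: T_def D_def lookup_times_single)
  qed
  then have "T l \<noteq> 0" using fl by simp
  ultimately have "(\<Sum>k\<in>Poly_Mapping.keys f - {l}. T k) \<noteq> 0"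
    using sum.remove[OF finite_keys l_key, of T] by (metis add.right_neutral)
  then have "\<exists>k\<in>Poly_Mapping.keys f - {l}. T k \<noteq> 0"
    by (meson sum.neutral)
  then obtain k where k: "k \<in> Poly_Mapping.keys f" "k \<noteq> l" "T k \<noteq> 0"
    by blast
  have k_seq: "k \<in> seqs r (Suc q)" using k(1) f' by (auto simp: free_module_def)
  have "Poly_Mapping.lookup (delta_basis m k :: (nat list, 'n, 'k) fmod) n \<noteq> 0"
    using k(3) by (auto simp: T_def)
  then obtain y where y: "y \<in> set k" "n = removeAll y k"
    using lookup_delta_basis_neq_0[OF seqs_sorted[OF k_seq]] by metis
  then have "T k = Poly_Mapping.lookup (Poly_Mapping.lookup f k *
      Poly_Mapping.single (?m k - ?m n) (pos_sign k y)) D"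
    by (simp add: T_def lookup_delta_basis_removeAll[OF seqs_sorted[OF k_seq]])
  then obtain t where t: "D = t + (?m k - ?m n)" "Poly_Mapping.lookup (Poly_Mapping.lookup f k) t \<noteq> 0"
    using lookup_times_single_neq_0 k(3) by metis
  have "set n \<subseteq> set l" using xn(1) by auto
  then have total: "D + ?m n = s + ?m l"
    unfolding D_def add.assoc by (simp only: mon_dvd_diff_add lcm_seq_mono)
  have "set n \<subseteq> set k" using y(2) by auto
  then have total': "D + ?m n = t + ?m k"
    unfolding t(1) add.assoc by (simp only: mon_dvd_diff_add lcm_seq_mono)
  have "(t, k) \<in> fterms f" using t(2) by (simp add: fterms_def)
  then have "prec (t, k) (s, l)" using greatest(2) k(2) by simp
  then have "multi_less d m ord (t, k) (s, l)"
    by (simp only: prec_def taylor_less_iff[OF ord k_seq l])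
  then have less: "seq_prec d k l"
    using ord total total' by (auto simp: multi_less_def term_order_def irreflp_def)
  obtain z n' where z: "k = pcons d z n'" "n' \<in> seqs r q" "z \<in> {1..r}"
    using seqs_Suc_cases[OF k_seq] by metis
  have less': "seq_prec d n' n \<or> n' = n \<and> before d z x"
    using less seq_prec_pcons seqs_length[OF z(2)] seqs_length[OF xn(2)] unfolding z(1) xn(1) by metis
  \<comment> \<open>If \<open>y \<noteq> z\<close>, then \<open>n\<close>, which is \<open>k\<close> without \<open>y\<close>, would be smaller than \<open>n'\<close>, which is
    \<open>k\<close> without \<open>z\<close>, and hence \<open>l\<close> would be smaller than \<open>k\<close>.\<close>
  have "before d z x"
  proof (cases "y = z")
    case True
    then have "n = n'" using y(2) z(1) removeAll_absent_pcons k_seq by metis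
    then show ?thesis using less' by simp
  next
    case False
    then have "y \<in> set n'" "n = pcons d z (removeAll y n')" using y by (auto simp: z(1) removeAll_pcons)
    then have "seq_prec d n n'" using seq_prec_removeAll k_seq z(1) by metis
    then show ?thesis using less' seq_prec_trans seq_prec_irrefl by blast
  qed
  define p where "p = pcons d z l"
  have p: "p \<in> seqs r (Suc (Suc q))"
    unfolding p_def pcons_in_seqs using z(3) l \<open>before d z x\<close> xn by (auto intro: before_trans)
  have "mon_dvd (?m p) (s + ?m l)"
  proof -
    have "mon_dvd (?m l) (s + ?m l)" "mon_dvd (?m k) (s + ?m l)"
      using total' unfolding total[symmetric] by (metis add.commute mon_dvd_def total)+
    then show ?thesis by (auto simp: mon_dvd_lcm_seq p_def z(1))
  qed
  then obtain w where "s + ?m l = ?m p + w" by (auto simp: mon_dvd_def)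
  also have "?m p = (?m p - ?m l) + ?m l"
    by (intro mon_dvd_diff_add[symmetric] lcm_seq_mono) (auto simp: p_def)
  finally have "s + ?m l = (?m p - ?m l) + w + ?m l" by (simp add: ac_simps)
  then have "s = (?m p - ?m l) + w" by simp
  moreover have "lt prec (delta_basis m p :: (nat list, 'n, 'k) fmod) = (?m p - ?m l, l)"
    unfolding prec_def p_def using lt_taylor_less_delta_basis[OF ord] p p_def by blast
  ultimately have "term_dvd (lt prec (delta_basis m p :: (nat list, 'n, 'k) fmod)) (lt prec f)"
    by (auto simp: term_dvd_def sl)
  with p show ?thesis by blast
qed

lemma submodule_free_module: "submodule (free_module B :: ('b, 'n, 'k::field) fmod set)"
proof (rule fmod.subspaceI)
  show "0 \<in> (free_module B :: ('b, 'n, 'k) fmod set)" by (simp add: free_module_def)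
next
  fix f g :: "('b, 'n, 'k) fmod" assume "f \<in> free_module B" "g \<in> free_module B"
  then show "f + g \<in> free_module B"
    using keys_add[of f g] by (auto simp: free_module_def)
qed (rule fscale_in_free_module)

lemma submodule_kernel: "submodule {f \<in> taylor_module r q. delta m f = (0 :: (nat list, 'n, 'k::field) fmod)}"
proof -
  note free = submodule_free_module[of "seqs r q", folded taylor_module_def]
  show ?thesis
  proof (rule fmod.subspaceI)
    show "0 \<in> {f \<in> taylor_module r q. delta m f = (0 :: (nat list, 'n, 'k) fmod)}"
      using fmod.subspace_0[OF free] by simp
  next
    fix f g assume "f \<in> {f \<in> taylor_module r q. delta m f = (0 :: (nat list, 'n, 'k) fmod)}"
      "g \<in> {f \<in> taylor_module r q. delta m f = (0 :: (nat list, 'n, 'k) fmod)}"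
    then show "f + g \<in> {f \<in> taylor_module r q. delta m f = (0 :: (nat list, 'n, 'k) fmod)}"
      using fmod.subspace_add[OF free, of f g] by (simp add: delta_add)
  next
    fix p f assume "f \<in> {f \<in> taylor_module r q. delta m f = (0 :: (nat list, 'n, 'k) fmod)}"
    then show "fscale p f \<in> {f \<in> taylor_module r q. delta m f = (0 :: (nat list, 'n, 'k) fmod)}"
      using fmod.subspace_scale[OF free, of f p] by (simp add: delta_fscale)
  qed
qed

lemma submodule_image: "submodule (delta m ` (taylor_module r q :: (nat list, 'n, 'k::field) fmod set))"
proof -
  note free = submodule_free_module[of "seqs r q", folded taylor_module_def]
  show ?thesis
  proof (rule fmod.subspaceI)
    show "0 \<in> delta m ` (taylor_module r q :: (nat list, 'n, 'k) fmod set)"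
      using imageI[OF fmod.subspace_0[OF free], of "delta m"] by simp
  next
    fix f g assume "f \<in> delta m ` (taylor_module r q :: (nat list, 'n, 'k) fmod set)"
      "g \<in> delta m ` (taylor_module r q :: (nat list, 'n, 'k) fmod set)"
    then show "f + g \<in> delta m ` (taylor_module r q :: (nat list, 'n, 'k) fmod set)"
      by (elim imageE) (simp only: delta_add[symmetric] imageI fmod.subspace_add[OF free])
  next
    fix p f assume "f \<in> delta m ` (taylor_module r q :: (nat list, 'n, 'k) fmod set)"
    then show "fscale p f \<in> delta m ` (taylor_module r q :: (nat list, 'n, 'k) fmod set)"
      by (elim imageE) (simp only: delta_fscale[symmetric] imageI fmod.subspace_scale[OF free])
  qed
qed

lemma finite_Delta: "finite (Delta m r q)"
  by (simp add: Delta_def Setcompr_eq_image finite_seqs)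

lemma Delta_subset_kernel:
  "(Delta m r q :: (nat list, 'n, 'k::field) fmod set) \<subseteq> {f \<in> taylor_module r q. delta m f = 0}"
proof
  fix g :: "(nat list, 'n, 'k) fmod" assume "g \<in> Delta m r q"
  then obtain k where "g = delta_basis m k" "k \<in> seqs r (Suc q)" unfolding Delta_def by blast
  then show "g \<in> {f \<in> taylor_module r q. delta m f = 0}"
    using delta_basis_in_free_module[of k r q m, where 'k = 'k] delta_delta_basis[OF seqs_sorted, of k r "Suc q" m, where 'k = 'k]
    by (simp add: taylor_module_def)
qed

lemma Delta_subset_image:
  "(Delta m r q :: (nat list, 'n, 'k::field) fmod set) \<subseteq> delta m ` taylor_module r (Suc q)"
proof
  fix g :: "(nat list, 'n, 'k) fmod" assume "g \<in> Delta m r q"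
  then obtain k where k: "g = delta_basis m k" "k \<in> seqs r (Suc q)" unfolding Delta_def by blast
  then have "g = delta m (Poly_Mapping.single k 1)" by (simp add: delta_single)
  moreover have "Poly_Mapping.single k 1 \<in> (taylor_module r (Suc q) :: (nat list, 'n, 'k) fmod set)"
    using k(2) by (simp add: taylor_module_def free_module_def)
  ultimately show "g \<in> delta m ` taylor_module r (Suc q)" by (rule image_eqI)
qed

lemma image_subset_kernel:
  "delta m ` (taylor_module r (Suc q) :: (nat list, 'n, 'k::field) fmod set)
     \<subseteq> {f \<in> taylor_module r q. delta m f = 0}"
proof
  fix g :: "(nat list, 'n, 'k) fmod" assume "g \<in> delta m ` taylor_module r (Suc q)"
  then obtain f where f: "g = delta m f" "Poly_Mapping.keys f \<subseteq> seqs r (Suc q)"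
    by (auto simp: taylor_module_def free_module_def)
  show "g \<in> {f \<in> taylor_module r q. delta m f = 0}"
    unfolding f(1) delta_def[of m f]
  proof (rule fmod.subspace_sum[OF submodule_kernel], rule fmod.subspace_scale[OF submodule_kernel])
    fix k assume "k \<in> Poly_Mapping.keys f"
    then have "delta_basis m k \<in> (Delta m r q :: (nat list, 'n, 'k) fmod set)"
      using f(2) unfolding Delta_def by blast
    then show "delta_basis m k \<in> {f \<in> taylor_module r q. delta m f = (0 :: (nat list, 'n, 'k) fmod)}"
      using Delta_subset_kernel by (rule rev_subsetD)
  qed
qed

lemma groebner_basis_DeltaI:
  fixes J :: "(nat list, 'n, 'k::field) fmod set"
  assumes "submodule J" "Delta m r q \<subseteq> J"
    and "\<And>f. f \<in> J \<Longrightarrow> f \<noteq> 0 \<Longrightarrow> \<exists>k\<in>seqs r (Suc q).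
      term_dvd (lt prec (delta_basis m k :: (nat list, 'n, 'k) fmod)) (lt prec f)"
  shows "groebner_basis prec J (Delta m r q)"
  unfolding groebner_basis_def
proof (intro conjI ballI impI)
  fix f assume "f \<in> J" "f \<noteq> 0"
  then obtain k where k: "k \<in> seqs r (Suc q)"
    and dvd: "term_dvd (lt prec (delta_basis m k :: (nat list, 'n, 'k) fmod)) (lt prec f)"
    using assms(3) by meson
  show "\<exists>g\<in>(Delta m r q :: (nat list, 'n, 'k) fmod set). g \<noteq> 0 \<and> term_dvd (lt prec g) (lt prec f)"
  proof (rule bexI)
    show "delta_basis m k \<in> (Delta m r q :: (nat list, 'n, 'k) fmod set)"
      using k unfolding Delta_def by blast
    show "delta_basis m k \<noteq> (0 :: (nat list, 'n, 'k) fmod) \<and>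
        term_dvd (lt prec (delta_basis m k :: (nat list, 'n, 'k) fmod)) (lt prec f)"
      by (rule conjI[OF delta_basis_neq_0[OF k] dvd])
  qed
qed (rule assms(1) assms(2) finite_Delta)+

lemma groebner_basis_subset:
  assumes "groebner_basis prec J G" "submodule J'" "G \<subseteq> J'" "J' \<subseteq> J"
  shows "groebner_basis prec J' G"
proof -
  have "finite G"
    using assms(1) unfolding groebner_basis_def by (elim conjE)
  have J: "\<forall>f\<in>J. f \<noteq> 0 \<longrightarrow> (\<exists>g\<in>G. g \<noteq> 0 \<and> term_dvd (lt prec g) (lt prec f))"
    using assms(1) unfolding groebner_basis_def by (elim conjE)
  have "\<forall>f\<in>J'. f \<noteq> 0 \<longrightarrow> (\<exists>g\<in>G. g \<noteq> 0 \<and> term_dvd (lt prec g) (lt prec f))"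
    by (rule ballI) (rule bspec[OF J subsetD[OF assms(4)]])
  with assms(2,3) \<open>finite G\<close> show ?thesis
    unfolding groebner_basis_def by (intro conjI)
qed

lemma groebner_basis_kernel:
  assumes ord: "term_order ord"
  shows "groebner_basis (taylor_less TYPE('k::field) d m ord (Suc q))
    {f \<in> taylor_module r (Suc q). delta m f = 0} (Delta m r (Suc q) :: (nat list, 'n, 'k) fmod set)"
proof (rule groebner_basis_DeltaI[OF submodule_kernel Delta_subset_kernel])
  fix f :: "(nat list, 'n, 'k) fmod"
  assume "f \<in> {f \<in> taylor_module r (Suc q). delta m f = 0}" "f \<noteq> 0"
  then have "f \<in> taylor_module r (Suc q)" "f \<noteq> 0" "delta m f = 0" by simp_all
  then show "\<exists>p\<in>seqs r (Suc (Suc q)).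
    term_dvd (lt (taylor_less TYPE('k) d m ord (Suc q)) (delta_basis m p :: (nat list, 'n, 'k) fmod))
      (lt (taylor_less TYPE('k) d m ord (Suc q)) f)"
    by (rule kernel_lt_divisible[OF ord])
qed

text \<open>
  In a monomial ideal every monomial of an element is a multiple of some generator.
\<close>

lemma groebner_basis_monomial_ideal:
  assumes ord: "term_order ord"
  shows "groebner_basis (taylor_less TYPE('k::field) d m ord 0)
    (delta m ` taylor_module r (Suc 0)) (Delta m r 0 :: (nat list, 'n, 'k) fmod set)"
proof (rule groebner_basis_DeltaI[OF submodule_image Delta_subset_image])
  let ?prec = "taylor_less TYPE('k::field) d m ord 0"
  fix f :: "(nat list, 'n, 'k) fmod"
  assume im: "f \<in> delta m ` taylor_module r (Suc 0)" and "f \<noteq> 0"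
  obtain h where h: "f = delta m h" "h \<in> free_module (seqs r (Suc 0))"
    using im unfolding taylor_module_def by blast
  have f: "f \<in> free_module (seqs r 0)"
    using subsetD[OF image_subset_kernel im] by (simp add: taylor_module_def)
  obtain s l where sl: "lt ?prec f = (s, l)" by (cases "lt ?prec f")
  have lt: "(s, l) \<in> fterms f"
    using lt_greatest(1)[OF strict_order_taylor_less[OF ord] f \<open>f \<noteq> 0\<close>] sl by metis
  then have l: "l = []" using fterms_free_module[OF f] by (auto simp: seqs_0)
  have "Poly_Mapping.lookup (Poly_Mapping.lookup f l) s =
    (\<Sum>k\<in>Poly_Mapping.keys h. Poly_Mapping.lookup (Poly_Mapping.lookup h k *
       Poly_Mapping.lookup (delta_basis m k) l) s)"
    by (simp add: h(1) delta_def lookup_sum lookup_fscale)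
  moreover have "Poly_Mapping.lookup (Poly_Mapping.lookup f l) s \<noteq> 0"
    using lt by (simp add: fterms_def)
  ultimately obtain k where k: "k \<in> Poly_Mapping.keys h"
    "Poly_Mapping.lookup (Poly_Mapping.lookup h k *
       Poly_Mapping.lookup (delta_basis m k) l) s \<noteq> 0"
    by (metis (no_types, lifting) sum.neutral)
  have "k \<in> seqs r (Suc 0)" using k(1) h(2) by (auto simp: free_module_def)
  then obtain x where x: "k = pcons d x l" "pcons d x l \<in> seqs r (Suc 0)"
    using seqs_Suc_cases[of k r 0 d] by (auto simp: seqs_0 l)
  have "Poly_Mapping.lookup (delta_basis m k :: (nat list, 'n, 'k) fmod) l
      = Poly_Mapping.single (lcm_seq m k - lcm_seq m l) (pos_sign k x)"
    using lookup_delta_basis_removeAll[OF seqs_sorted[OF x(2)], of x m] removeAll_absent_pcons[OF x(2)]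
    by (simp add: x(1))
  with k(2) obtain t where "s = t + (lcm_seq m k - lcm_seq m l)"
    using lookup_times_single_neq_0 by metis
  then have "term_dvd (lt ?prec (delta_basis m k :: (nat list, 'n, 'k) fmod)) (lt ?prec f)"
    unfolding sl x(1) lt_taylor_less_delta_basis[OF ord x(2)] term_dvd_def
    by (auto simp: add.commute)
  then show "\<exists>k\<in>seqs r (Suc 0). term_dvd (lt ?prec (delta_basis m k :: (nat list, 'n, 'k) fmod)) (lt ?prec f)"
    using \<open>k \<in> seqs r (Suc 0)\<close> by (rule bexI)
qed

text \<open>
  In positive degrees the boundaries are cycles and contain the generators, so the basis of the cycles
  serves as well.
\<close>

lemma groebner_basis_image:
  assumes ord: "term_order ord"
  shows "groebner_basis (taylor_less TYPE('k::field) d m ord q)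
    (delta m ` taylor_module r (Suc q)) (Delta m r q :: (nat list, 'n, 'k) fmod set)"
proof (cases q)
  case 0
  then show ?thesis using groebner_basis_monomial_ideal[OF ord] by simp
next
  case (Suc q')
  show ?thesis
    unfolding Suc
    by (rule groebner_basis_subset[OF groebner_basis_kernel[OF ord] submodule_image
          Delta_subset_image image_subset_kernel])
qed

section \<open>Schreyer syzygies of the Taylor generators\<close>

text \<open>
  In both arrangements a generator with a later number loses the comparison of indices; this matches
  the convention of the Schreyer order, in which the later of two basis elements is the smaller one.
\<close>

lemma numbering_iff:
  "numbering d r q ks \<longleftrightarrow> set ks = seqs r q \<and> sorted_wrt (\<lambda>k l. tiebreak d l k) ks"
  by (cases d) (simp_all add: numbering_def tiebreak_def)

lemma tiebreak_irrefl [simp]: "\<not> tiebreak d k k"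
  by (cases d) (simp_all add: tiebreak_def)

lemma tiebreak_asym: "tiebreak d k l \<Longrightarrow> \<not> tiebreak d l k"
  using seq_less_trans[of k l k] seq_less_trans[of l k l] by (cases d) (auto simp: tiebreak_def)

lemma numbering_less_iff:
  assumes "numbering d r q ks" "a < length ks" "b < length ks"
  shows "a < b \<longleftrightarrow> tiebreak d (ks ! b) (ks ! a)"
proof
  show "a < b \<Longrightarrow> tiebreak d (ks ! b) (ks ! a)"
    using assms sorted_wrt_nth_less[of "\<lambda>k l. tiebreak d l k" ks a b] by (simp add: numbering_iff)
next
  assume less: "tiebreak d (ks ! b) (ks ! a)"
  show "a < b"
  proof (rule ccontr)
    assume "\<not> a < b"
    then consider "a = b" | "b < a" by linarith
    then show False
    proof cases
      case 1
      then show False using less by simp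
    next
      case 2
      then have "tiebreak d (ks ! a) (ks ! b)"
        using assms sorted_wrt_nth_less[of "\<lambda>k l. tiebreak d l k" ks b a] by (simp add: numbering_iff)
      then show False using less tiebreak_asym by blast
    qed
  qed
qed

lemma numbering_distinct:
  assumes "numbering d r q ks"
  shows "distinct ks"
proof -
  have "ks ! a \<noteq> ks ! b" if "a < length ks" "b < length ks" "a < b" for a b
    using numbering_less_iff[OF assms that(1,2)] that(3) by auto
  then show ?thesis by (metis distinct_conv_nth nat_neq_iff)
qed

lemma lookup_relabel:
  assumes "distinct ks" "f \<in> free_module {..<length ks}" "a < length ks"
  shows "Poly_Mapping.lookup (relabel ks f) (ks ! a) = Poly_Mapping.lookup f a"
proof -
  have "Poly_Mapping.lookup (relabel ks f) (ks ! a)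
      = (\<Sum>b\<in>Poly_Mapping.keys f. if b = a then Poly_Mapping.lookup f a else 0)"
    unfolding relabel_def lookup_sum
  proof (intro sum.cong refl)
    fix b assume "b \<in> Poly_Mapping.keys f"
    then have "b < length ks" using assms(2) by (auto simp: free_module_def)
    then have "ks ! b = ks ! a \<longleftrightarrow> b = a" using assms(1,3) by (simp add: nth_eq_iff_index_eq)
    then show "Poly_Mapping.lookup (Poly_Mapping.single (ks ! b) (Poly_Mapping.lookup f b)) (ks ! a)
        = (if b = a then Poly_Mapping.lookup f a else 0)"
      by (simp add: lookup_single when_def)
  qed
  also have "\<dots> = Poly_Mapping.lookup f a"
    by (auto simp: sum.delta' in_keys_iff)
  finally show ?thesis .
qed

lemma relabel_in_free_module:
  assumes "f \<in> free_module {..<length ks}"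
  shows "relabel ks f \<in> free_module (set ks)"
  unfolding relabel_def
proof (rule fmod.subspace_sum[OF submodule_free_module])
  fix a assume "a \<in> Poly_Mapping.keys f"
  then have "a < length ks" using assms by (auto simp: free_module_def)
  then show "Poly_Mapping.single (ks ! a) (Poly_Mapping.lookup f a) \<in> free_module (set ks)"
    by (auto simp: free_module_def)
qed

lemma free_module_eqI:
  assumes "f \<in> free_module (set ks)" "g \<in> free_module (set ks)"
    and "\<And>a. a < length ks \<Longrightarrow> Poly_Mapping.lookup f (ks ! a) = Poly_Mapping.lookup g (ks ! a)"
  shows "f = g"
proof (rule poly_mapping_eqI)
  fix k
  show "Poly_Mapping.lookup f k = Poly_Mapping.lookup g k"
  proof (cases "k \<in> set ks")
    case True
    then show ?thesis using assms(3) by (metis in_set_conv_nth)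
  next
    case False
    then have "k \<notin> Poly_Mapping.keys f" "k \<notin> Poly_Mapping.keys g"
      using assms(1,2) by (auto simp: free_module_def)
    then show ?thesis by (simp add: in_keys_iff)
  qed
qed

lemma delta_relabel:
  assumes "f \<in> free_module {..<length ks}"
  shows "delta m (relabel ks f)
    = (\<Sum>c<length ks. fscale (Poly_Mapping.lookup f c) (map (delta_basis m) ks ! c))"
proof -
  have "delta m (relabel ks f)
      = (\<Sum>c\<in>Poly_Mapping.keys f. fscale (Poly_Mapping.lookup f c) (delta_basis m (ks ! c)))"
    unfolding relabel_def delta_sum delta_single ..
  also have "\<dots> = (\<Sum>c<length ks. fscale (Poly_Mapping.lookup f c) (delta_basis m (ks ! c)))"
    using assms by (intro sum.mono_neutral_left) (auto simp: free_module_def in_keys_iff)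
  finally show ?thesis by simp
qed

lemma relabel_surj:
  assumes "distinct ks" "f \<in> free_module (set ks)"
  obtains g where "g \<in> free_module {..<length ks}" "relabel ks g = f"
proof
  let ?g = "\<Sum>a<length ks. Poly_Mapping.single a (Poly_Mapping.lookup f (ks ! a))"
  show g: "?g \<in> free_module {..<length ks}"
    by (intro fmod.subspace_sum[OF submodule_free_module]) (auto simp: free_module_def)
  show "relabel ks ?g = f"
  proof (rule free_module_eqI[OF relabel_in_free_module[OF g] assms(2)])
    fix a assume a: "a < length ks"
    show "Poly_Mapping.lookup (relabel ks ?g) (ks ! a) = Poly_Mapping.lookup f (ks ! a)"
      unfolding lookup_relabel[OF assms(1) g a] using a
      by (simp add: lookup_sum lookup_single when_def sum.delta')
  qed
qed

lemma relabel_syz: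
  assumes "distinct ks"
  shows "relabel ks ` syz (map (delta_basis m) ks :: (nat list, 'n, 'k::field) fmod list) = {f \<in> free_module (set ks). delta m f = 0}"
proof (intro equalityI subsetI)
  fix f :: "(nat list, 'n, 'k) fmod" assume "f \<in> relabel ks ` syz (map (delta_basis m) ks)"
  then obtain p where p: "f = relabel ks p" "p \<in> free_module {..<length ks}"
      "(\<Sum>c<length ks. fscale (Poly_Mapping.lookup p c) (map (delta_basis m) ks ! c)) = 0"
    by (auto simp: syz_def)
  then show "f \<in> {f \<in> free_module (set ks). delta m f = 0}"
    by (simp only: mem_Collect_eq relabel_in_free_module delta_relabel simp_thms)
next
  fix f :: "(nat list, 'n, 'k) fmod" assume "f \<in> {f \<in> free_module (set ks). delta m f = 0}"
  then have f: "f \<in> free_module (set ks)" "delta m f = 0" by simp_all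
  obtain p where p: "p \<in> free_module {..<length ks}" "relabel ks p = f"
    using relabel_surj[OF assms f(1)] .
  have "p \<in> syz (map (delta_basis m) ks :: (nat list, 'n, 'k) fmod list)"
    using f(2) delta_relabel[OF p(1), of m] p unfolding syz_def by simp
  then show "f \<in> relabel ks ` syz (map (delta_basis m) ks)"
    using p(2) by blast
qed

text \<open>
  The adjoined entry is the first entry in the descending case and the last of \<open>q + 1\<close> entries
  in the ascending case.
\<close>

lemma pos_sign_pivot:
  assumes "pcons d x n \<in> seqs r (Suc q)"
  shows "(pos_sign (pcons d x n) x :: 'k::field) = (case d of Descending \<Rightarrow> 1 | Ascending \<Rightarrow> (-1) ^ q)"
proof -
  have n: "n \<in> seqs r q" "\<And>y. y \<in> set n \<Longrightarrow> before d x y" using assms by (auto simp: pcons_in_seqs)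
  have card: "card (set n) = q"
    using distinct_card[OF distinct_if_sorted[OF seqs_sorted[OF n(1)]]] seqs_length[OF n(1)] by simp
  show ?thesis
  proof (cases d)
    case Descending
    then have "{y \<in> set (pcons d x n). y < x} = {}" using n(2) by (fastforce simp: before_def)
    then show ?thesis by (simp only: pos_sign_def) (simp add: Descending)
  next
    case Ascending
    then have "{y \<in> set (pcons d x n). y < x} = set n" using n(2) by (fastforce simp: before_def)
    then show ?thesis by (simp only: pos_sign_def) (simp add: Ascending card)
  qed
qed

text \<open>
  The factor by which a Schreyer syzygy differs from the matching \<open>\<delta> v\<^sub>p\<close>.
\<close>

definition taylor_sign :: "arrangement \<Rightarrow> 'k::field" where
  "taylor_sign d = (case d of Descending \<Rightarrow> 1 | Ascending \<Rightarrow> -1)"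

definition pivot :: "arrangement \<Rightarrow> nat list \<Rightarrow> nat" where
  "pivot d k = (case d of Descending \<Rightarrow> hd k | Ascending \<Rightarrow> last k)"

lemma pivot_pcons [simp]: "pivot d (pcons d x n) = x"
  by (cases d) (simp_all add: pivot_def pcons_def)

text \<open>
  The relation \<open>\<delta> (\<delta> v\<^sub>p) = 0\<close>, solved for the two summands that form the S-polynomial of the
  generators numbered \<open>a < b\<close>. These generators are indexed by \<open>k = pcons d x n\<close> and
  \<open>pcons d y n\<close>, so that \<open>p\<close> arises from \<open>k\<close> by adjoining the entry \<open>y\<close>.
\<close>

definition taylor_representation :: "arrangement \<Rightarrow> (nat \<Rightarrow> 'n mon) \<Rightarrow> nat list list
    \<Rightarrow> nat \<Rightarrow> nat \<Rightarrow> nat \<Rightarrow> ('n, 'k::field) mpoly" where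
  "taylor_representation d m ks a b c = (if c \<in> {a, b} then 0 else
     - (Poly_Mapping.single 0 (taylor_sign d) *
        Poly_Mapping.lookup (delta_basis m (pcons d (pivot d (ks ! b)) (ks ! a))) (ks ! c)))"

text \<open>
  Two generators \<open>\<delta> v\<^sub>k\<close> and \<open>\<delta> v\<^sub>l\<close> have leading terms in the same component exactly if
  \<open>k\<close> and \<open>l\<close> agree except for the adjoined entries \<open>x\<close> and \<open>y\<close>. If the second one has the
  larger number, then \<open>y\<close> comes before \<open>x\<close>, and \<open>k\<close> and \<open>l\<close> together form one sequence
  \<open>p\<close> of the next length.
\<close>

locale schreyer_pair =
  fixes d :: arrangement and m :: "nat \<Rightarrow> 'n mon"
    and ord :: "'n mon \<Rightarrow> 'n mon \<Rightarrow> bool" and r q :: nat and ks :: "nat list list"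
    and a b x y :: nat and n :: "nat list"
    and prec :: "(nat list, 'n) fterm \<Rightarrow> (nat list, 'n) fterm \<Rightarrow> bool"
    and gs :: "(nat list, 'n, 'k::field) fmod list"
  assumes ord: "term_order ord" and ks: "numbering d r (Suc q) ks"
    and ab: "a < length ks" "b < length ks" and ks_a: "ks ! a = pcons d x n" and ks_b: "ks ! b = pcons d y n"
    and p: "pcons d y (pcons d x n) \<in> seqs r (Suc (Suc q))"
    and prec: "prec = taylor_less TYPE('k) d m ord q"
    and gs: "gs = map (delta_basis m) ks"
begin

abbreviation "M \<equiv> lcm_seq m"
abbreviation "\<Delta> k \<equiv> (delta_basis m k :: (nat list, 'n, 'k) fmod)"
abbreviation "k \<equiv> pcons d x n"
abbreviation "l \<equiv> pcons d y n"
abbreviation "p \<equiv> pcons d y k"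
abbreviation "P \<equiv> (taylor_representation d m ks a b :: nat \<Rightarrow> ('n, 'k) mpoly)"
abbreviation "\<epsilon> \<equiv> (taylor_sign d :: 'k)"

lemma nth_gs: "c < length ks \<Longrightarrow> gs ! c = \<Delta> (ks ! c)"
  by (simp add: gs)

lemma length_gs: "length gs = length ks"
  by (simp add: gs)

lemma gs_ab: "gs ! a = \<Delta> k" "gs ! b = \<Delta> l"
  using ab by (simp_all add: nth_gs ks_a ks_b)

lemma generators_in_seqs: "k \<in> seqs r (Suc q)" "l \<in> seqs r (Suc q)" "n \<in> seqs r q"
  and entries_before: "before d y x" "\<And>z. z \<in> set n \<Longrightarrow> before d x z" "\<And>z. z \<in> set n \<Longrightarrow> before d y z"
  using p by (auto simp: pcons_in_seqs)

lemma entries_distinct: "x \<noteq> y" "x \<notin> set n" "y \<notin> set n"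
  using entries_before before_irrefl by metis+

lemma index_neq: "a \<noteq> b"
  using entries_distinct(1) ks_a ks_b by auto

lemma removeAll_entries: "removeAll y p = k" "removeAll x p = l" "removeAll x k = n" "removeAll y l = n"
  using entries_distinct by (auto simp: removeAll_pcons)

lemma lcm_seq_p: "M p = mon_lcm (M k) (M l)" "M p = mon_lcm (M l) (M k)"
  by (intro lcm_seq_Un; auto)+

lemma lcm_seq_dvd: "mon_dvd (M n) (M k)" "mon_dvd (M n) (M l)" "mon_dvd (M k) (M p)" "mon_dvd (M l) (M p)"
  by (intro lcm_seq_mono; auto)+

lemma lt_gens: "lt prec (\<Delta> k) = (M k - M n, n)" "lt prec (\<Delta> l) = (M l - M n, n)"
  unfolding prec by (rule lt_taylor_less_delta_basis[OF ord] generators_in_seqs)+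

lemma lookup_p:
  "Poly_Mapping.lookup (\<Delta> p) k = Poly_Mapping.single (M p - M k) (pos_sign p y)"
  "Poly_Mapping.lookup (\<Delta> p) l = Poly_Mapping.single (M p - M l) (pos_sign p x)"
  using lookup_delta_basis_removeAll[OF seqs_sorted[OF p], of y m, where 'k = 'k]
    lookup_delta_basis_removeAll[OF seqs_sorted[OF p], of x m, where 'k = 'k]
  by (simp_all add: removeAll_entries)

lemma lookup_generators:
  "Poly_Mapping.lookup (\<Delta> k) n = Poly_Mapping.single (M k - M n) (pos_sign k x)"
  "Poly_Mapping.lookup (\<Delta> l) n = Poly_Mapping.single (M l - M n) (pos_sign l y)"
  using lookup_delta_basis_removeAll[OF seqs_sorted[OF generators_in_seqs(1)], of x m, where 'k = 'k]
    lookup_delta_basis_removeAll[OF seqs_sorted[OF generators_in_seqs(2)], of y m, where 'k = 'k]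
  by (simp_all add: removeAll_entries)

text \<open>
  The coefficients of \<open>v\<^sub>k\<close> and \<open>v\<^sub>l\<close> in \<open>\<delta> v\<^sub>p\<close> have opposite signs, like the two terms of an
  S-polynomial; so one common factor matches both.
\<close>

lemma pos_sign_relations:
  "(pos_sign k x :: 'k) = \<epsilon> * pos_sign p y" "- (pos_sign l y :: 'k) = \<epsilon> * pos_sign p x"
proof -
  have kl: "(pos_sign l y :: 'k) = pos_sign k x"
    using pos_sign_pivot[OF generators_in_seqs(1)] pos_sign_pivot[OF generators_in_seqs(2)] by metis
  show k: "(pos_sign k x :: 'k) = \<epsilon> * pos_sign p y"
    unfolding pos_sign_pivot[OF generators_in_seqs(1)] pos_sign_pivot[OF p] taylor_sign_def by (cases d) simp_all
  have "pos_sign p y * pos_sign k x = - (pos_sign p x * pos_sign l y :: 'k)"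
    using pos_sign_swap[of x p y, where 'k = 'k] entries_distinct(1) removeAll_entries by simp
  then have "pos_sign p x = - (pos_sign p y :: 'k)"
    unfolding kl by (metis mult_cancel_right mult_minus_left minus_minus pos_sign_neq_0)
  then show "- (pos_sign l y :: 'k) = \<epsilon> * pos_sign p x"
    by (simp add: kl k)
qed

lemma same_component_ab: "same_component prec (gs ! a) (gs ! b)"
  by (simp add: same_component_def gs_ab lt_gens)

lemma spoly_coeffs:
  "spoly_coeff prec (gs ! a) (gs ! b) = Poly_Mapping.single (M p - M k) (pos_sign k x)"
  "spoly_coeff prec (gs ! b) (gs ! a) = Poly_Mapping.single (M p - M l) (pos_sign l y)"
proof -
  have "lc prec (\<Delta> k) = pos_sign k x" "lc prec (\<Delta> l) = pos_sign l y"
    by (simp_all add: lc_def lt_gens lookup_generators)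
  then show "spoly_coeff prec (gs ! a) (gs ! b) = Poly_Mapping.single (M p - M k) (pos_sign k x)"
    "spoly_coeff prec (gs ! b) (gs ! a) = Poly_Mapping.single (M p - M l) (pos_sign l y)"
    using mon_lcm_quotient[OF lcm_seq_dvd(1,2)] mon_lcm_quotient[OF lcm_seq_dvd(2,1)]
    by (simp_all add: spoly_coeff_def gs_ab lt_gens lcm_seq_p[symmetric] pos_sign_inverse)
qed

abbreviation "S \<equiv> schreyer_syz prec gs (taylor_representation d m ks) a b"

lemma S_eq: "S = Poly_Mapping.single a (Poly_Mapping.single (M p - M k) (pos_sign k x))
     - Poly_Mapping.single b (Poly_Mapping.single (M p - M l) (pos_sign l y))
     - (\<Sum>c<length ks. Poly_Mapping.single c (P c))"
  by (simp only: schreyer_syz_def same_component_ab spoly_coeffs if_True length_gs)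

lemma S_in_free_module: "S \<in> free_module {..<length ks}"
  unfolding S_eq
  by (intro fmod.subspace_diff fmod.subspace_sum submodule_free_module)
    (use ab in \<open>auto simp: free_module_def\<close>)

lemma lookup_S:
  assumes "c < length ks"
  shows "Poly_Mapping.lookup S c = Poly_Mapping.single 0 \<epsilon> * Poly_Mapping.lookup (\<Delta> p) (ks ! c)"
proof -
  have "Poly_Mapping.lookup S c = (if a = c then Poly_Mapping.single (M p - M k) (pos_sign k x) else 0)
      - (if b = c then Poly_Mapping.single (M p - M l) (pos_sign l y) else 0) - P c"
    using assms by (simp add: S_eq lookup_minus lookup_sum lookup_single when_def sum.delta)
  also have "\<dots> = Poly_Mapping.single 0 \<epsilon> * Poly_Mapping.lookup (\<Delta> p) (ks ! c)"
  proof -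
    consider "c = a" | "c = b" | "c \<noteq> a" "c \<noteq> b" by blast
    then show ?thesis
    proof cases
      case 1
      then show ?thesis
        using index_neq by (simp add: taylor_representation_def ks_a lookup_p mult_single pos_sign_relations(1))
    next
      case 2
      then show ?thesis
        using index_neq by (simp add: taylor_representation_def ks_b lookup_p mult_single pos_sign_relations(2)[symmetric] single_uminus)
    next
      case 3
      then show ?thesis
        by (simp add: taylor_representation_def ks_a ks_b)
    qed
  qed
  finally show ?thesis .
qed

text \<open>
  At \<open>a\<close> and \<open>b\<close> the S-polynomial supplies the two coefficients of \<open>\<delta> v\<^sub>p\<close>, elsewhere the
  representation does.
\<close>

lemma relabel_S: "relabel ks S = fscale (Poly_Mapping.single 0 \<epsilon>) (\<Delta> p)"
proof (rule free_module_eqI[OF relabel_in_free_module[OF S_in_free_module]])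
  show "fscale (Poly_Mapping.single 0 \<epsilon>) (\<Delta> p) \<in> free_module (set ks)"
    using ks delta_basis_in_free_module[OF p] unfolding numbering_iff by (auto intro: fscale_in_free_module)
  fix c assume "c < length ks"
  then show "Poly_Mapping.lookup (relabel ks S) (ks ! c)
      = Poly_Mapping.lookup (fscale (Poly_Mapping.single 0 \<epsilon>) (\<Delta> p)) (ks ! c)"
    by (simp add: lookup_relabel[OF numbering_distinct[OF ks] S_in_free_module] lookup_S lookup_fscale)
qed

lemma spoly_eq: "spoly prec (gs ! a) (gs ! b)
   = fscale (Poly_Mapping.single (M p - M k) (pos_sign k x)) (\<Delta> k)
     - fscale (Poly_Mapping.single (M p - M l) (pos_sign l y)) (\<Delta> l)"
  using spoly_coeffs by (simp only: spoly_def gs_ab)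

lemma spoly_representation:
  "spoly prec (gs ! a) (gs ! b) = (\<Sum>c<length gs. fscale (P c) (gs ! c))"
proof -
  have "0 = delta m (relabel ks S)"
    unfolding relabel_S delta_fscale delta_delta_basis[OF seqs_sorted[OF p]] by simp
  also have "\<dots> = (\<Sum>c<length ks. fscale (Poly_Mapping.lookup S c) (gs ! c))"
    using delta_relabel[OF S_in_free_module, of m] unfolding gs .
  \<comment> \<open>Separate the S-polynomial from its representation in the coefficients of the syzygy.\<close>
  also have "\<dots> = (\<Sum>c<length ks. (if a = c then fscale (Poly_Mapping.single (M p - M k) (pos_sign k x)) (\<Delta> k) else 0)
      - (if b = c then fscale (Poly_Mapping.single (M p - M l) (pos_sign l y)) (\<Delta> l) else 0) - fscale (P c) (gs ! c))"
  proof (intro sum.cong refl)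
    fix c assume c: "c \<in> {..<length ks}"
    have "Poly_Mapping.lookup S c = (if a = c then Poly_Mapping.single (M p - M k) (pos_sign k x) else 0)
        - (if b = c then Poly_Mapping.single (M p - M l) (pos_sign l y) else 0) - P c"
      using c by (simp add: S_eq lookup_minus lookup_sum lookup_single when_def sum.delta)
    then show "fscale (Poly_Mapping.lookup S c) (gs ! c)
      = (if a = c then fscale (Poly_Mapping.single (M p - M k) (pos_sign k x)) (\<Delta> k) else 0)
      - (if b = c then fscale (Poly_Mapping.single (M p - M l) (pos_sign l y)) (\<Delta> l) else 0) - fscale (P c) (gs ! c)"
      using index_neq gs_ab by (auto simp: fmod.scale_left_diff_distrib)
  qed
  also have "\<dots> = spoly prec (gs ! a) (gs ! b) - (\<Sum>c<length gs. fscale (P c) (gs ! c))"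
    using ab by (simp only: sum_subtractf spoly_eq length_gs) (simp add: sum.delta)
  finally show ?thesis by simp
qed

lemma spoly_in_free_module: "spoly prec (gs ! a) (gs ! b) \<in> free_module (seqs r q)"
  unfolding spoly_eq
  by (intro fmod.subspace_diff[OF submodule_free_module] fscale_in_free_module delta_basis_in_free_module generators_in_seqs)

text \<open>
  The summand with index \<open>p\<close> minus \<open>z\<close> has its leading term at \<open>n' = k\<close> minus \<open>z\<close>. This
  term also occurs in the S-polynomial, since \<open>n'\<close> contains \<open>x\<close> and hence cannot come from
  \<open>\<delta> v\<^sub>l\<close>. So it does not exceed the leading term of the S-polynomial, which in particular does not
  vanish.
\<close>

lemma standard_taylor_representation: "standard_representation prec gs (spoly prec (gs ! a) (gs ! b)) P"
  unfolding standard_representation_def Let_def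
proof (intro conjI allI impI)
  show "spoly prec (gs ! a) (gs ! b) = (\<Sum>c<length gs. fscale (P c) (gs ! c))"
    by (rule spoly_representation)
  fix c assume "c < length gs" and Pc: "P c \<noteq> 0"
  let ?f = "spoly prec (gs ! a) (gs ! b)"
  have c: "c < length ks" using \<open>c < length gs\<close> by (simp add: length_gs)
  have c_ab: "c \<noteq> a" "c \<noteq> b" and P_eq: "P c = - (Poly_Mapping.single 0 \<epsilon> * Poly_Mapping.lookup (\<Delta> p) (ks ! c))"
    using Pc unfolding taylor_representation_def ks_a ks_b pivot_pcons by (auto split: if_splits)
  have "Poly_Mapping.lookup (\<Delta> p) (ks ! c) \<noteq> 0" using Pc P_eq by auto
  then obtain z where z: "z \<in> set p" "ks ! c = removeAll z p"
    using lookup_delta_basis_neq_0[OF seqs_sorted[OF p]] by metis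
  have "ks ! c \<noteq> k" "ks ! c \<noteq> l"
    using c_ab nth_eq_iff_index_eq[OF numbering_distinct[OF ks] c] ab ks_a ks_b by metis+
  then have "z \<noteq> x" "z \<noteq> y" using z(2) removeAll_entries by auto
  then have zn: "z \<in> set n" using z(1) by simp
  define n' where "n' = pcons d x (removeAll z n)"
  have n': "n' = removeAll z k" and ks_c: "ks ! c = pcons d y n'"
    using z(2) \<open>z \<noteq> x\<close> \<open>z \<noteq> y\<close> by (auto simp: n'_def removeAll_pcons)
  have c_seq: "pcons d y n' \<in> seqs r (Suc q)"
    using removeAll_in_seqs[OF p z(1)] z(2) ks_c by simp
  have sub: "set n' \<subseteq> set k" "set n' \<subseteq> set (pcons d y n')" "set (pcons d y n') \<subseteq> set p"
    by (auto simp: n')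
  have "P c = Poly_Mapping.single (M p - M (pcons d y n')) (- (\<epsilon> * pos_sign p z))"
    using lookup_delta_basis_removeAll[OF seqs_sorted[OF p] z(1), of m, where 'k = 'k]
    unfolding P_eq z(2)[symmetric] ks_c by (simp add: mult_single single_uminus)
  moreover have "- (\<epsilon> * pos_sign p z) \<noteq> 0"
    by (cases d) (simp_all add: taylor_sign_def)
  ultimately have lt_c: "lt prec (fscale (P c) (gs ! c))
      = (M p - M (pcons d y n') + (M (pcons d y n') - M n'), n')"
    using lt_taylor_less_multiple[OF ord c_seq, where c = "- (\<epsilon> * pos_sign p z)"] by (simp add: prec nth_gs[OF c] ks_c)
  also have "M p - M (pcons d y n') + (M (pcons d y n') - M n') = M p - M n'"
    by (intro mon_quotient_trans lcm_seq_mono sub)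
  finally have lt_c: "lt prec (fscale (P c) (gs ! c)) = (M p - M n', n')" .
  \<comment> \<open>Now the coefficient of the S-polynomial at \<open>n'\<close> is seen to be a nonzero monomial.\<close>
  have l0: "Poly_Mapping.lookup (\<Delta> l) n' = 0"
  proof (rule ccontr)
    assume "Poly_Mapping.lookup (\<Delta> l) n' \<noteq> 0"
    then obtain w where "n' = removeAll w l"
      using lookup_delta_basis_neq_0[OF seqs_sorted[OF generators_in_seqs(2)]] by metis
    then have "x \<in> set l" unfolding n'_def by (metis set_pcons insertI1 set_removeAll DiffD1)
    then show False using entries_distinct by simp
  qed
  have k': "Poly_Mapping.lookup (\<Delta> k) n' = Poly_Mapping.single (M k - M n') (pos_sign k z)"
    unfolding n' by (rule lookup_delta_basis_removeAll[OF seqs_sorted[OF generators_in_seqs(1)]]) (simp add: zn)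
  have quot: "M p - M k + (M k - M n') = M p - M n'"
    by (intro mon_quotient_trans lcm_seq_dvd lcm_seq_mono sub)
  have "Poly_Mapping.lookup ?f n' = Poly_Mapping.single (M p - M n') (pos_sign k x * pos_sign k z)"
    unfolding spoly_eq by (simp add: lookup_minus lookup_fscale l0 k' mult_single quot)
  then have mem: "(M p - M n', n') \<in> fterms ?f"
    by (simp add: fterms_def)
  then show f: "?f \<noteq> 0" using fterms_eq_empty_iff by blast
  show "prec (lt prec (fscale (P c) (gs ! c))) (lt prec ?f) \<or> lt prec (fscale (P c) (gs ! c)) = lt prec ?f"
    unfolding lt_c using lt_greatest(2)[OF strict_order_taylor_less[OF ord, where 'k = 'k, of r q d m, folded prec] spoly_in_free_module f mem] by blast
qed

end

lemma schreyer_less_iff: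
  fixes m :: "nat \<Rightarrow> 'n mon"
  assumes ks: "numbering d r q' ks" and ab: "a < length ks" "b < length ks"
  shows "schreyer_less (taylor_less TYPE('k::field) d m ord q)
      (map (delta_basis m) ks :: (nat list, 'n, 'k) fmod list) (s, a) (t, b)
    \<longleftrightarrow> taylor_less TYPE('k) d m ord (Suc q) (s, ks ! a) (t, ks ! b)"
proof -
  have "b < a \<longleftrightarrow> (case d of Descending \<Rightarrow> seq_less (ks ! a) (ks ! b) | Ascending \<Rightarrow> seq_less (ks ! b) (ks ! a))"
    using numbering_less_iff[OF ks ab(2,1)] by (simp add: tiebreak_def)
  then show ?thesis
    using ab by (simp add: schreyer_less_def Let_def)
qed

lemma schreyer_pairI:
  assumes ord: "term_order ord" and ks: "numbering d r (Suc q) ks" and ab: "a < b" "b < length ks"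
    and gs: "gs = map (delta_basis m) ks" and prec: "prec = taylor_less TYPE('k::field) d m ord q"
    and same: "same_component prec (gs ! a) (gs ! b :: (nat list, 'n, 'k) fmod)"
  shows "\<exists>x y n. schreyer_pair d m ord r q ks a b x y n prec gs"
proof -
  have seqs: "ks ! a \<in> seqs r (Suc q)" "ks ! b \<in> seqs r (Suc q)"
    using ks ab nth_mem[of a ks] nth_mem[of b ks] unfolding numbering_iff by (metis less_trans)+
  obtain x n where x: "ks ! a = pcons d x n" using seqs_Suc_cases[OF seqs(1), where d = d] by metis
  obtain y n' where y: "ks ! b = pcons d y n'" "y \<in> {1..r}" "\<And>z. z \<in> set n' \<Longrightarrow> before d y z"
    using seqs_Suc_cases[OF seqs(2), where d = d] by metis
  have "lt prec (gs ! a) = (lcm_seq m (pcons d x n) - lcm_seq m n, n)"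
    "lt prec (gs ! b) = (lcm_seq m (pcons d y n') - lcm_seq m n', n')"
    using lt_taylor_less_delta_basis[OF ord] seqs ab unfolding prec gs x y(1) by (simp_all add: x y(1))
  then have n: "n' = n" using same by (simp add: same_component_def)
  have "tiebreak d (ks ! b) (ks ! a)"
    using numbering_less_iff[OF ks, of a b] ab by simp
  then have "before d y x" by (simp add: x y(1) n tiebreak_pcons)
  then have "pcons d y (pcons d x n) \<in> seqs r (Suc (Suc q))"
    using y seqs(1) unfolding x n by (auto simp: pcons_in_seqs)
  then have "schreyer_pair d m ord r q ks a b x y n prec gs"
    using ord ks ab x y(1) gs prec by unfold_locales (simp_all add: n)
  then show ?thesis by blast
qed

text \<open>
  Removing from \<open>p\<close> either of the two entries that were adjoined last recovers the pair.
\<close>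

lemma schreyer_pair_of_seq:
  assumes ord: "term_order ord" and ks: "numbering d r (Suc q) ks" and p: "p \<in> seqs r (Suc (Suc q))"
    and gs: "gs = (map (delta_basis m) ks :: (nat list, 'n, 'k) fmod list)"
    and prec: "prec = taylor_less TYPE('k::field) d m ord q"
  shows "\<exists>a b x y n. a < b \<and> b < length ks \<and> p = pcons d y (pcons d x n) \<and>
     schreyer_pair d m ord r q ks a b x y n prec gs"
proof -
  obtain y k where k: "p = pcons d y k" "y \<in> {1..r}" "k \<in> seqs r (Suc q)"
      "\<And>z. z \<in> set k \<Longrightarrow> before d y z"
    using seqs_Suc_cases[OF p, where d = d] by metis
  obtain x n where x: "k = pcons d x n" "n \<in> seqs r q" using seqs_Suc_cases[OF k(3), where d = d] by metis
  have l: "pcons d y n \<in> seqs r (Suc q)"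
    using k(2,4) x by (simp add: pcons_in_seqs)
  obtain a b where ab: "a < length ks" "b < length ks" "ks ! a = k" "ks ! b = pcons d y n"
    using ks k(3) l unfolding numbering_iff by (metis in_set_conv_nth)
  have "tiebreak d (ks ! b) (ks ! a)"
    using k(4)[of x] by (simp add: ab x tiebreak_pcons)
  then have "a < b" using numbering_less_iff[OF ks ab(1,2)] by simp
  moreover have "schreyer_pair d m ord r q ks a b x y n prec gs"
    using ord ks ab p k(1) x(1) gs prec by unfold_locales simp_all
  ultimately show ?thesis
    using ab(2) k(1) x(1) by blast
qed

lemma relabel_0: "relabel ks 0 = 0"
  by (simp add: relabel_def)

lemma standard_choice_taylor_representation:
  assumes ord: "term_order ord" and ks: "numbering d r (Suc q) ks"
  shows "standard_choice (taylor_less TYPE('k::field) d m ord q)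
    (map (delta_basis m) ks :: (nat list, 'n, 'k) fmod list) (taylor_representation d m ks)"
  unfolding standard_choice_def
proof (intro allI impI)
  let ?prec = "taylor_less TYPE('k) d m ord q"
    and ?gs = "map (delta_basis m) ks :: (nat list, 'n, 'k) fmod list"
  fix a b assume ab: "a < b" "b < length ?gs" and same: "same_component ?prec (?gs ! a) (?gs ! b)"
  have "b < length ks" using ab(2) by simp
  then obtain x y n where "schreyer_pair d m ord r q ks a b x y n ?prec ?gs"
    using schreyer_pairI[OF ord ks ab(1) _ refl refl same] by blast
  then show "standard_representation ?prec ?gs (spoly ?prec (?gs ! a) (?gs ! b)) (taylor_representation d m ks a b)"
    by (rule schreyer_pair.standard_taylor_representation)
qed

lemma relabel_schreyer_basis:
  fixes d :: arrangement and m :: "nat \<Rightarrow> 'n mon"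
  assumes ord: "term_order ord" and ks: "numbering d r (Suc q) ks"
  defines "prec \<equiv> taylor_less TYPE('k::field) d m ord q"
    and "gs \<equiv> map (delta_basis m) ks :: (nat list, 'n, 'k) fmod list"
  shows "relabel ks ` (schreyer_basis prec gs (taylor_representation d m ks) - {0})
    = {fscale (Poly_Mapping.single 0 (taylor_sign d)) (delta_basis m k) | k. k \<in> seqs r (Suc (Suc q))}"
    (is "_ ` (?B - {0}) = ?R")
proof (intro equalityI subsetI)
  fix f assume "f \<in> relabel ks ` (?B - {0})"
  then obtain a b where ab: "a < b" "b < length ks" and f: "f = relabel ks (schreyer_syz prec gs (taylor_representation d m ks) a b)"
    and nz: "schreyer_syz prec gs (taylor_representation d m ks) a b \<noteq> 0"
    by (auto simp: schreyer_basis_def gs_def)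
  have "same_component prec (gs ! a) (gs ! b)"
    using nz by (auto simp: schreyer_syz_def split: if_splits)
  then obtain x y n where pair: "schreyer_pair d m ord r q ks a b x y n prec gs"
    using schreyer_pairI[OF ord ks ab] gs_def prec_def by metis
  show "f \<in> ?R"
    using schreyer_pair.relabel_S[OF pair] schreyer_pair.p[OF pair] unfolding f by blast
next
  fix f assume "f \<in> ?R"
  then obtain p where f: "f = fscale (Poly_Mapping.single 0 (taylor_sign d)) (delta_basis m p)"
    and p: "p \<in> seqs r (Suc (Suc q))"
    by blast
  obtain a b x y n where ab: "a < b" "b < length ks" and p_eq: "p = pcons d y (pcons d x n)"
    and pair: "schreyer_pair d m ord r q ks a b x y n prec gs"
    using schreyer_pair_of_seq[OF ord ks p] gs_def prec_def by metis
  let ?S = "schreyer_syz prec gs (taylor_representation d m ks) a b"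
  have f_eq: "relabel ks ?S = f"
    using schreyer_pair.relabel_S[OF pair] unfolding f p_eq .
  have "f \<noteq> 0"
  proof
    assume "f = 0"
    have "(taylor_sign d :: 'k) * taylor_sign d = 1" by (cases d) (simp_all add: taylor_sign_def)
    then have "fscale (Poly_Mapping.single 0 (taylor_sign d)) f = delta_basis m p"
      unfolding f by (simp add: fmod.scale_scale mult_single)
    then show False
      using delta_basis_neq_0[OF p, of m, where 'k = 'k] \<open>f = 0\<close> by simp
  qed
  then have "?S \<noteq> 0" using f_eq relabel_0 by metis
  moreover have "?S \<in> ?B" using ab by (auto simp: schreyer_basis_def gs_def)
  ultimately show "f \<in> relabel ks ` (?B - {0})"
    using f_eq by blast
qed

theorem theorem3p4:
  fixes m :: "nat \<Rightarrow> ('n::finite) mon" and r q :: nat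
    and ord :: "'n mon \<Rightarrow> 'n mon \<Rightarrow> bool" and d :: arrangement
    and ks :: "nat list list"
    and prec prec' :: "(nat list, 'n) fterm \<Rightarrow> (nat list, 'n) fterm \<Rightarrow> bool"
    and gs :: "(nat list, 'n, 'k::field) fmod list"
  assumes "inj_on m {1..r}" and "term_order ord"
    and "1 \<le> q" and "q \<le> r"
    and "numbering d r q ks"
  defines "prec \<equiv> taylor_less TYPE('k) d m ord (q - 1)"
    and "prec' \<equiv> taylor_less TYPE('k) d m ord q"
    and "gs \<equiv> map (delta_basis m) ks"
  shows "groebner_basis prec (delta m ` taylor_module r q)
           (Delta m r (q - 1) :: (nat list, 'n, 'k) fmod set) \<and>
         (\<forall>s t. \<forall>a<length ks. \<forall>b<length ks.
            schreyer_less prec gs (s, a) (t, b) \<longleftrightarrow> prec' (s, ks ! a) (t, ks ! b)) \<and>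
         (\<exists>P. standard_choice prec gs P \<and>
            (\<exists>\<epsilon> :: nat list \<Rightarrow> ('n, 'k) mpoly. (\<forall>k. \<epsilon> k \<in> {1, -1}) \<and>
               relabel ks ` (schreyer_basis prec gs P - {0}) =
                 {fscale (\<epsilon> k) (delta_basis m k) | k. k \<in> seqs r (Suc q)})) \<and>
         relabel ks ` syz gs = {f \<in> taylor_module r q. delta m f = 0} \<and>
         groebner_basis prec' {f \<in> taylor_module r q. delta m f = 0}
           (Delta m r q :: (nat list, 'n, 'k) fmod set)"
proof -
  obtain q' where q: "q = Suc q'"
    using \<open>1 \<le> q\<close> by (cases q) simp_all
  note ord = \<open>term_order ord\<close>
  have ks: "numbering d r (Suc q') ks" using \<open>numbering d r q ks\<close> unfolding q .
  have prec: "prec = taylor_less TYPE('k) d m ord q'" by (simp add: prec_def q)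
  have image: "groebner_basis prec (delta m ` taylor_module r q) (Delta m r (q - 1) :: (nat list, 'n, 'k) fmod set)"
    unfolding prec q diff_Suc_1 by (rule groebner_basis_image[OF ord])
  have order: "\<forall>s t. \<forall>a<length ks. \<forall>b<length ks.
      schreyer_less prec gs (s, a) (t, b) \<longleftrightarrow> prec' (s, ks ! a) (t, ks ! b)"
    unfolding prec prec'_def gs_def q using schreyer_less_iff[OF ks] by blast
  have sign: "(Poly_Mapping.single 0 (taylor_sign d) :: ('n, 'k) mpoly) \<in> {1, -1}"
    by (cases d) (simp_all add: taylor_sign_def single_uminus)
  have "standard_choice prec gs (taylor_representation d m ks)"
    unfolding prec gs_def by (rule standard_choice_taylor_representation[OF ord ks])
  moreover have "relabel ks ` (schreyer_basis prec gs (taylor_representation d m ks) - {0}) =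
      {fscale (Poly_Mapping.single 0 (taylor_sign d)) (delta_basis m k) | k. k \<in> seqs r (Suc q)}"
    unfolding prec gs_def q by (rule relabel_schreyer_basis[OF ord ks])
  ultimately have schreyer: "\<exists>P. standard_choice prec gs P \<and>
      (\<exists>\<epsilon> :: nat list \<Rightarrow> ('n, 'k) mpoly. (\<forall>k. \<epsilon> k \<in> {1, -1}) \<and>
         relabel ks ` (schreyer_basis prec gs P - {0}) =
           {fscale (\<epsilon> k) (delta_basis m k) | k. k \<in> seqs r (Suc q)})"
    using sign by (intro exI[of _ "taylor_representation d m ks"] conjI
        exI[of _ "\<lambda>_. Poly_Mapping.single 0 (taylor_sign d)"] allI)
  have "set ks = seqs r q" using ks by (simp add: numbering_iff q)
  then have syz: "relabel ks ` syz gs = {f \<in> taylor_module r q. delta m f = 0}"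
    using relabel_syz[OF numbering_distinct[OF ks], of m, where 'k = 'k]
    unfolding gs_def taylor_module_def by simp
  have kernel: "groebner_basis prec' {f \<in> taylor_module r q. delta m f = 0}
      (Delta m r q :: (nat list, 'n, 'k) fmod set)"
    unfolding prec'_def q by (rule groebner_basis_kernel[OF ord])
  show ?thesis
    by (intro conjI image order schreyer syz kernel)
qed

end
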